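(* Let $n \ge 1$ and $t\ge 0$ be integers, and let $\alpha:X\to Y$ be one of the three projections $$h:S^{2n-1}\to\mathbb{C}P^{n-1},\qquad \pi:\mathbb{C}P^{n-1}\to\Delta_{n-1},\qquad \tau_2:S^{2n-1}\to\Delta_{n-1},$$ with generic fiber $T$ (isomorphic to $S^1$, $T(\mathrm{PSU}(n))$, $T(\mathrm{SO}(2n))$, respectively). Let $s=2t+1$ if $X=S^{2n-1}$ and $s=t$ if $X=\mathbb{C}P^{n-1}$. Given an interior (or boundary) $t$-cubature formula $F_Y$ for $Y$ and an interior $s$-cubature formula $F_T$ for $T$, there is a twisted product $s$-cubature formula $F_X=F_T\ltimes F_Y$ for $X$. It satisfies $|F_X|=|F_T|\,|F_Y|$ when $F_Y$ is interior, and $|F_X|\le|F_T|\,|F_Y|$ in the boundary case. If $F_T$ and $F_Y$ are positive, then so is $F_X$.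
   Context: Cubature: for a space $Z$ with normalized measure $\mu$ and a notion of polynomials of degree $\le d$, a $d$-cubature formula $F$ is a finite set of points $\{p_a\}$ with real weights $w_a$ such that $\int P\,d\mu=\sum_a w_aP(p_a)$ for all polynomials $P$ of degree at most $d$. It is positive if all $w_a>0$; interior if all $p_a$ lie in the interior of $Z$; boundary if all $p_a$ lie in $Z$ and some $p_a$ lies in $\partial Z$. (Spheres, projective spaces and tori have no boundary, so there "interior" means the points lie in the space.) $|F|$ is the number of points. Spaces: $S^{2n-1}\subset\mathbb{C}^n=\mathbb{R}^{2n}$ is the unit sphere with uniform measure and polynomials on $\mathbb{R}^{2n}$. $\mathbb{C}P^{n-1}$ has points $(z_1:\cdots:z_n)$ normalized so that $\sum|z_k|^2=1$, with the unitarily invariant measure; polynomials of degree $\le d$ are polynomials of degree $\le d$ in the coordinates $z_k\overline{z_j}$. $\Delta_{n-1}$ is the $(n-1)$-simplex in barycentric coordinates with uniform measure, interior taken relative to its affine span. Maps: $h$ is the Hopf map sending a point to the complex line containing it; $\pi(z_1:\cdots:z_n)=(|z_1|^2,\ldots,|z_n|^2)$; $\tau_2=\pi\circ h$, i.e. $\tau_2(x_1,\ldots,x_{2n})=(x_1^2+x_2^2,\ldots,x_{2n-1}^2+x_{2n}^2)$. Tori, with normalized Haar measure: for $h$, $T=S^1$ acts on $S^{2n-1}$ by complex scalar multiplication, and polynomials of degree $\le d$ on $S^1$ are spanned by $z^k$, $|k|\le d$. For $\tau_2$, $T=T(\mathrm{SO}(2n))=(S^1)^n$ acts on $S^{2n-1}\subset\mathbb{C}^n$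 coordinatewise, and polynomials of degree $\le d$ are spanned by characters $z_1^{k_1}\cdots z_n^{k_n}$ with $\sum|k_i|\le d$. For $\pi$, $T=T(\mathrm{PSU}(n))$, the diagonal unitary matrices modulo scalars, acts on $\mathbb{C}P^{n-1}$, and polynomials of degree $\le d$ are spanned by products of at most $d$ functions $z_j\overline{z_k}$. In each case $Y$ is the set of $T$-orbits in $X$ and $\alpha$ the orbit map. Twisted product: for each point $p$ of $F_Y$ of weight $w$ choose a base point $q_p\in\alpha^{-1}(p)$; the formula $F_T\ltimes F_Y$ consists of all points $g\cdot q_p$ with weight $wv_g$, where $g$ runs over the points of $F_T$ with weights $v_g$ (over singular fibers coinciding points are merged and their weights added). *)

theory Defs
  imports "HOL-Probability.Probability" "HOL-Library.Multiset"
begin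

section \<open>Cubature formulas\<close>

record ('a, 'b) cub_space =
  carr :: "'a set"
  bdry :: "'a set"
  meas :: "'a measure"
  polys :: "nat \<Rightarrow> ('a \<Rightarrow> 'b) set"

record 'a formula =
  nodes :: "'a set"
  weight :: "'a \<Rightarrow> real"

text \<open>Only the values of \<open>weight F\<close> on \<open>nodes F\<close> are meaningful.\<close>

definition cubature ::
  "('a, 'b::{banach, second_countable_topology}) cub_space \<Rightarrow> nat \<Rightarrow> 'a formula \<Rightarrow> bool" where
  "cubature Z d F \<longleftrightarrow> finite (nodes F) \<and>
     (\<forall>P \<in> polys Z d. (\<integral>x. P x \<partial>meas Z) = (\<Sum>p\<in>nodes F. weight F p *\<^sub>R P p))"

definition positive_formula :: "'a formula \<Rightarrow> bool" where
  "positive_formula F \<longleftrightarrow> (\<forall>p \<in> nodes F. weight F p > 0)"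

definition interior_formula :: "('a, 'b) cub_space \<Rightarrow> 'a formula \<Rightarrow> bool" where
  "interior_formula Z F \<longleftrightarrow> nodes F \<subseteq> carr Z - bdry Z"

definition boundary_formula :: "('a, 'b) cub_space \<Rightarrow> 'a formula \<Rightarrow> bool" where
  "boundary_formula Z F \<longleftrightarrow> nodes F \<subseteq> carr Z \<and> nodes F \<inter> bdry Z \<noteq> {}"

section \<open>Polynomials\<close>

definition lin_span :: "('a \<Rightarrow> 'b::comm_ring_1) set \<Rightarrow> ('a \<Rightarrow> 'b) set" where
  "lin_span B = {(\<lambda>x. \<Sum>f\<in>S. c f * f x) | S c. finite S \<and> S \<subseteq> B}"

definition poly_deg_le :: "('a \<Rightarrow> 'b::comm_ring_1) set \<Rightarrow> nat \<Rightarrow> ('a \<Rightarrow> 'b) set" where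
  "poly_deg_le C d =
     lin_span {(\<lambda>x. \<Prod>f\<in>#m. f x) | m. set_mset m \<subseteq> C \<and> size m \<le> d}"

section \<open>Invariant measures\<close>

text \<open>The Borel \<open>\<sigma>\<close>-algebra of the quotient topology that \<open>q\<close> induces on \<open>q ` X\<close>;
  for \<open>q = id\<close> it is that of the subspace topology of \<open>X\<close>.\<close>

definition quotient_borel :: "'a::topological_space set \<Rightarrow> ('a \<Rightarrow> 'b) \<Rightarrow> 'b measure" where
  "quotient_borel X q =
     sigma (q ` X) {U. U \<subseteq> q ` X \<and> openin (top_of_set X) (X \<inter> q -` U)}"

definition invariant_prob :: "'a measure \<Rightarrow> ('a \<Rightarrow> 'a) set \<Rightarrow> 'a measure \<Rightarrow> bool" where
  "invariant_prob B \<Phi> M \<longleftrightarrow>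
     prob_space M \<and> sets M = sets B \<and> (\<forall>\<phi> \<in> \<Phi>. distr M M \<phi> = M)"

section \<open>The sphere\<close>

text \<open>The type \<open>complex ^ 'n\<close> is a real Euclidean space of dimension \<open>2 * CARD('n)\<close> with
  real coordinates \<open>Re (z $ k)\<close>, \<open>Im (z $ k)\<close>. The normalized surface measure of a subset of
  the sphere is the proportion of the ball taken up by the cone over that subset with apex \<open>0\<close>.
  The point \<open>0\<close>, where the radial projection is irrelevant, is a null set.\<close>

definition sphere_measure :: "(complex ^ 'n) measure" where
  "sphere_measure = distr (uniform_measure lborel (cball 0 1)) borel (\<lambda>z. z /\<^sub>R norm z)"

definition sphere_space :: "(complex ^ 'n, real) cub_space" where
  "sphere_space =
     \<lparr>carr = sphere 0 1,
      bdry = {},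
      meas = sphere_measure,
      polys = poly_deg_le ({(\<lambda>z. Re (z $ k)) | k. True} \<union> {(\<lambda>z. Im (z $ k)) | k. True})\<rparr>"

section \<open>Complex projective space\<close>

text \<open>Points of projective space are complex lines through the origin.\<close>

definition hopf :: "complex ^ 'n \<Rightarrow> (complex ^ 'n) set" where
  "hopf z = {c *s z | c. True}"

definition unit_rep :: "(complex ^ 'n) set \<Rightarrow> complex ^ 'n" where
  "unit_rep L = (SOME z. z \<in> L \<and> norm z = 1)"

definition unitary_matrix :: "complex ^ 'n ^ 'n \<Rightarrow> bool" where
  "unitary_matrix U \<longleftrightarrow>
     U ** (\<chi> i j. cnj (U $ j $ i)) = mat 1 \<and> (\<chi> i j. cnj (U $ j $ i)) ** U = mat 1"

definition unitarily_invariant :: "(complex ^ 'n) set measure \<Rightarrow> bool" where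
  "unitarily_invariant M \<longleftrightarrow>
     invariant_prob (quotient_borel (sphere 0 1) hopf)
       {(\<lambda>L. (\<lambda>z. U *v z) ` L) | U. unitary_matrix U} M"

text \<open>The functions \<open>z\<^sub>k * cnj z\<^sub>j\<close> and \<open>\<bar>z\<^sub>k\<bar>\<^sup>2\<close> of a unit representative do not depend
  on which representative \<open>unit_rep\<close> picks.\<close>

definition cp_space :: "(complex ^ 'n) set measure \<Rightarrow> ((complex ^ 'n) set, complex) cub_space" where
  "cp_space M =
     \<lparr>carr = hopf ` sphere 0 1,
      bdry = {},
      meas = M,
      polys = poly_deg_le {(\<lambda>L. unit_rep L $ k * cnj (unit_rep L $ j)) | k j. True}\<rparr>"

section \<open>The simplex\<close>

definition simplex_set :: "(real ^ 'n) set" where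
  "simplex_set = {y. (\<forall>i. 0 \<le> y $ i) \<and> (\<Sum>i\<in>UNIV. y $ i) = 1}"

text \<open>The simplex lies in a hyperplane, so the \<open>(n-1)\<close>-dimensional volume of a subset is
  proportional to the volume of the pyramid over it with apex \<open>0\<close>. As for the sphere,
  the uniform measure is therefore the radial projection of normalized Lebesgue measure.\<close>

definition simplex_measure :: "(real ^ 'n) measure" where
  "simplex_measure =
     distr (uniform_measure lborel {y. (\<forall>i. 0 \<le> y $ i) \<and> (\<Sum>i\<in>UNIV. y $ i) \<le> 1}) borel
       (\<lambda>y. y /\<^sub>R (\<Sum>i\<in>UNIV. y $ i))"

definition simplex_space :: "(real ^ 'n, real) cub_space" where
  "simplex_space =
     \<lparr>carr = simplex_set,
      bdry = rel_frontier simplex_set,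
      meas = simplex_measure,
      polys = poly_deg_le {(\<lambda>y. y $ i) | i. True}\<rparr>"

section \<open>Tori\<close>

definition haar_circle :: "complex measure \<Rightarrow> bool" where
  "haar_circle M \<longleftrightarrow>
     invariant_prob (quotient_borel (sphere 0 1) id) {(\<lambda>z. g * z) | g. g \<in> sphere 0 1} M"

definition circle_space :: "complex measure \<Rightarrow> (complex, complex) cub_space" where
  "circle_space M =
     \<lparr>carr = sphere 0 1,
      bdry = {},
      meas = M,
      polys = (\<lambda>d. lin_span {(\<lambda>z. z powi k) | k. \<bar>k\<bar> \<le> int d})\<rparr>"

text \<open>Multiplication on \<open>complex ^ 'n\<close> is componentwise. An element of \<open>torus_set\<close> is
  identified with the diagonal unitary matrix with these diagonal entries.\<close>

definition torus_set :: "(complex ^ 'n) set" where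
  "torus_set = {z. \<forall>i. cmod (z $ i) = 1}"

definition haar_torus :: "(complex ^ 'n) measure \<Rightarrow> bool" where
  "haar_torus M \<longleftrightarrow>
     invariant_prob (quotient_borel torus_set id) {(\<lambda>z. g * z) | g. g \<in> torus_set} M"

definition torus_space :: "(complex ^ 'n) measure \<Rightarrow> (complex ^ 'n, complex) cub_space" where
  "torus_space M =
     \<lparr>carr = torus_set,
      bdry = {},
      meas = M,
      polys = (\<lambda>d. lin_span {(\<lambda>z. \<Prod>i\<in>UNIV. (z $ i) powi (k i)) | k :: 'n \<Rightarrow> int.
                               (\<Sum>i\<in>UNIV. \<bar>k i\<bar>) \<le> int d})\<rparr>"

text \<open>\<open>phase_class z\<close> is the coset of the diagonal unitary matrix \<open>z\<close> modulo the scalar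
  unitary matrices. The set product \<open>class_mult\<close> serves both as the product of two cosets and
  as the action of a coset on a line.\<close>

definition phase_class :: "complex ^ 'n \<Rightarrow> (complex ^ 'n) set" where
  "phase_class z = {c *s z | c. cmod c = 1}"

definition class_mult :: "(complex ^ 'n) set \<Rightarrow> (complex ^ 'n) set \<Rightarrow> (complex ^ 'n) set" where
  "class_mult A B = {a * b | a b. a \<in> A \<and> b \<in> B}"

definition class_rep :: "(complex ^ 'n) set \<Rightarrow> complex ^ 'n" where
  "class_rep A = (SOME z. z \<in> A)"

definition haar_psu_torus :: "(complex ^ 'n) set measure \<Rightarrow> bool" where
  "haar_psu_torus M \<longleftrightarrow>
     invariant_prob (quotient_borel torus_set phase_class)
       {class_mult G | G. G \<in> phase_class ` torus_set} M"

definition psu_torus_space ::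
  "(complex ^ 'n) set measure \<Rightarrow> ((complex ^ 'n) set, complex) cub_space" where
  "psu_torus_space M =
     \<lparr>carr = phase_class ` torus_set,
      bdry = {},
      meas = M,
      polys = poly_deg_le {(\<lambda>G. class_rep G $ j * cnj (class_rep G $ k)) | j k. True}\<rparr>"

section \<open>Projections and twisted products\<close>

definition moment_map :: "(complex ^ 'n) set \<Rightarrow> real ^ 'n" where
  "moment_map L = (\<chi> k. (cmod (unit_rep L $ k))\<^sup>2)"

definition tau2 :: "complex ^ 'n \<Rightarrow> real ^ 'n" where
  "tau2 z = (\<chi> k. (Re (z $ k))\<^sup>2 + (Im (z $ k))\<^sup>2)"

definition base_points ::
  "('x, 'b) cub_space \<Rightarrow> ('x \<Rightarrow> 'y) \<Rightarrow> 'y formula \<Rightarrow> ('y \<Rightarrow> 'x) \<Rightarrow> bool" where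
  "base_points X \<alpha> F q \<longleftrightarrow> (\<forall>p \<in> nodes F. q p \<in> carr X \<and> \<alpha> (q p) = p)"

definition twisted_product ::
  "('g \<Rightarrow> 'x \<Rightarrow> 'x) \<Rightarrow> ('y \<Rightarrow> 'x) \<Rightarrow> 'g formula \<Rightarrow> 'y formula \<Rightarrow> 'x formula" where
  "twisted_product act q FT FY =
     \<lparr>nodes = {act g (q p) | g p. g \<in> nodes FT \<and> p \<in> nodes FY},
      weight = (\<lambda>x. \<Sum>(g, p) \<in> {(g, p) \<in> nodes FT \<times> nodes FY. act g (q p) = x}.
                 weight FY p * weight FT g)\<rparr>"

text \<open>The base points are an arbitrary choice in the construction, so the claim is made for every
  choice, together with the existence of one.\<close>

definition twisted_product_cubature ::
  "('x, 'b::{banach, second_countable_topology}) cub_space \<Rightarrow>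
   ('y, 'c::{banach, second_countable_topology}) cub_space \<Rightarrow>
   ('g, 'd::{banach, second_countable_topology}) cub_space \<Rightarrow>
   ('x \<Rightarrow> 'y) \<Rightarrow> ('g \<Rightarrow> 'x \<Rightarrow> 'x) \<Rightarrow> nat \<Rightarrow> nat \<Rightarrow> bool" where
  "twisted_product_cubature X Y T \<alpha> act t s \<longleftrightarrow>
     (\<forall>FY FT. cubature Y t FY \<longrightarrow> interior_formula Y FY \<or> boundary_formula Y FY \<longrightarrow>
        cubature T s FT \<longrightarrow> interior_formula T FT \<longrightarrow>
        (\<exists>q. base_points X \<alpha> FY q) \<and>
        (\<forall>q. base_points X \<alpha> FY q \<longrightarrow>
           (let FX = twisted_product act q FT FY in
              cubature X s FX \<and> interior_formula X FX \<and>
              (interior_formula Y FY \<longrightarrow>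
                 card (nodes FX) = card (nodes FT) * card (nodes FY)) \<and>
              (boundary_formula Y FY \<longrightarrow>
                 card (nodes FX) \<le> card (nodes FT) * card (nodes FY)) \<and>
              (positive_formula FT \<longrightarrow> positive_formula FY \<longrightarrow> positive_formula FX))))"

end

theory Submission
  imports Defs
begin

text \<open>The inner sums over \<open>F\<^sub>T\<close> replace a polynomial on \<open>X\<close> by its average over the \<open>T\<close>-orbits. Over
  \<open>\<complex>\<close> all polynomials are spanned by monomials \<open>z\<^sup>a\<close> times \<open>cnj z\<^sup>b\<close>, which are eigenfunctions of the
  torus, so averaging kills a monomial or leaves a function of \<open>\<alpha> z\<close> of degree at most \<open>t\<close> on \<open>Y\<close>
  (a surviving monomial has \<open>\<bar>a\<bar> = \<bar>b\<bar>\<close>, hence degree at most \<open>2 t\<close>). It remains to see that \<open>\<alpha>\<close>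
  maps the measure of \<open>X\<close> to that of \<open>Y\<close>, at least on monomials. For \<open>\<tau>\<^sub>2\<close> this is Archimedes'
  observation that \<open>\<bar>z\<bar>\<^sup>2\<close> pushes Lebesgue measure on \<open>\<complex>\<close> to \<open>\<pi>\<close> times Lebesgue measure on the half-line.
  For projective space, invariance under diagonal matrices and under rotations in two coordinates
  forces a recursion that determines all moments, so they agree with those of the sphere.\<close>

section \<open>Lebesgue measure and the sphere\<close>

text \<open>The measure on projective space is given only through its invariance, so it cannot be
  compared with the concrete sphere measure set by set; equality of moments takes the place of
  uniqueness of the invariant measure. Diagonal unitaries never relate two different moments E(b) of
  |z^b|^2. A rotation of coordinates i and j does: applied to a monomial that involves i but not j,
  it gives a polynomial identity in the squared tangent of the angle, and its coefficients yield
  (b_j + 1) E(b + e_i) = (b_i + 1) E(b + e_j). With sum |z_i|^2 = 1 the solution is E(b) = (n-1)!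
  (prod b_i!) / (n-1+|b|)!. The count of nodes is a separate matter: T acts freely over the interior
  of Y, because an interior point of the simplex has no zero coordinate, and only over the boundary
  can points g q_p merge.\<close>

lemma emeasure_lborel_cball_bounds:
  "emeasure lborel (cball 0 1 :: 'a::euclidean_space set) \<noteq> 0"
  "emeasure lborel (cball 0 1 :: 'a::euclidean_space set) \<noteq> \<infinity>"
  using content_cball_pos[of 1 "0::'a"] emeasure_bounded_finite[of "cball 0 1 :: 'a set"]
  by (auto simp: measure_def)

text \<open>Fubini shows that two translation-invariant measures are proportional; comparing them on the
  unit ball, which an isometry preserves, gives the factor 1.\<close>

lemma lborel_distr_linear_isometry:
  fixes T :: "'a::euclidean_space \<Rightarrow> 'a"
  assumes T: "linear T" and iso: "\<And>x. norm (T x) = norm x"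
  shows "distr lborel borel T = lborel"
proof -
  have [measurable]: "T \<in> borel_measurable borel"
    using T by (simp add: linear_continuous_on linear_linear borel_measurable_continuous_onI)
  have "inj T"
    using T iso by (metis linear_injective_0 norm_eq_zero)
  then have "surj T"
    using T linear_injective_imp_surjective by blast
  then obtain S where S: "\<And>y. T (S y) = y"
    by (metis surj_def)
  have tr: "(\<integral>\<^sup>+x. f (c + x) \<partial>lborel) = (\<integral>\<^sup>+x. f x \<partial>lborel)"
    if [measurable]: "f \<in> borel_measurable borel" for f :: "'a \<Rightarrow> ennreal" and c
    by (subst (2) lborel_distr_plus[of c, symmetric]) (simp add: nn_integral_distr)
  have refl: "(\<integral>\<^sup>+x. f (c - x) \<partial>lborel) = (\<integral>\<^sup>+x. f x \<partial>lborel)"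
    if [measurable]: "f \<in> borel_measurable borel" for f :: "'a \<Rightarrow> ennreal" and c
    by (subst (2) lborel_affine[of "-1" c]) (simp_all add: nn_integral_distr density_1)
  define B where "B = (cball 0 1 :: 'a set)"
  have [measurable]: "B \<in> sets borel" by (simp add: B_def)
  have TB: "T x \<in> B \<longleftrightarrow> x \<in> B" for x by (simp add: B_def iso)
  have B0: "emeasure lborel B \<noteq> 0" "emeasure lborel B \<noteq> \<infinity>"
    unfolding B_def by (rule emeasure_lborel_cball_bounds)+
  show ?thesis
  proof (rule measure_eqI)
    fix A assume "A \<in> sets (distr lborel borel T)"
    then have [measurable]: "A \<in> sets borel" by simp
    let ?I = "\<lambda>A x. indicator A x :: ennreal"
    have "emeasure lborel B * emeasure (distr lborel borel T) A
        = emeasure lborel B * (\<integral>\<^sup>+x. ?I A (T x) \<partial>lborel)"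
      by (simp add: nn_integral_distr flip: nn_integral_indicator)
    also have "\<dots> = (\<integral>\<^sup>+x. ?I A (T x) * emeasure lborel B \<partial>lborel)"
      by (subst nn_integral_multc) (simp_all add: mult.commute)
    also have "\<dots> = (\<integral>\<^sup>+x. \<integral>\<^sup>+y. ?I A (T x) * ?I B y \<partial>lborel \<partial>lborel)"
      by (simp add: nn_integral_cmult)
    \<comment> \<open>Here y is shifted by T x. After the exchange of integrals x is shifted by - S
      y, which turns T x + y back into T x and leaves T x - y in the indicator of A; its y-integral
      no longer depends on T.\<close>
    also have "\<dots> = (\<integral>\<^sup>+x. \<integral>\<^sup>+y. ?I A (T x) * ?I B (T x + y) \<partial>lborel \<partial>lborel)"
      by (intro nn_integral_cong tr[symmetric]) simp
    also have "\<dots> = (\<integral>\<^sup>+y. \<integral>\<^sup>+x. ?I A (T x) * ?I B (T x + y) \<partial>lborel \<partial>lborel)"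
      by (rule lborel_pair.Fubini') simp
    also have "\<dots> = (\<integral>\<^sup>+y. \<integral>\<^sup>+x. ?I A (T (- S y + x)) * ?I B (T (- S y + x) + y) \<partial>lborel \<partial>lborel)"
      by (intro nn_integral_cong tr[symmetric]) simp
    also have "\<dots> = (\<integral>\<^sup>+y. \<integral>\<^sup>+x. ?I A (T x - y) * ?I B x \<partial>lborel \<partial>lborel)"
    proof -
      have "T (- S y + x) = T x - y" for x y
        using linear_add[OF T, of "- S y" x] linear_neg[OF T, of "S y"] S by simp
      then show ?thesis using TB by (simp add: indicator_def)
    qed
    also have "\<dots> = (\<integral>\<^sup>+x. \<integral>\<^sup>+y. ?I A (T x - y) * ?I B x \<partial>lborel \<partial>lborel)"
      by (rule lborel_pair.Fubini') simp
    also have "\<dots> = (\<integral>\<^sup>+x. emeasure lborel A * ?I B x \<partial>lborel)"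
      by (simp add: nn_integral_multc refl)
    also have "\<dots> = emeasure lborel B * emeasure lborel A"
      by (subst nn_integral_cmult) (simp_all add: mult.commute)
    finally show "emeasure (distr lborel borel T) A = emeasure lborel A"
      using B0 by (simp add: ennreal_mult_cancel_left)
  qed simp
qed

section \<open>Lebesgue measure under coordinatewise squared moduli\<close>

lemma borel_measurable_vec_lambda:
  fixes f :: "'n::finite \<Rightarrow> 'b \<Rightarrow> 'a::euclidean_space"
  assumes "\<And>i. f i \<in> borel_measurable M"
  shows "(\<lambda>x. \<chi> i. f i x) \<in> borel_measurable M"
  using assms by (subst borel_measurable_euclidean_space) (auto simp: Basis_vec_def inner_axis)

text \<open>Lebesgue measure is determined by the volumes of boxes. A box of vectors is a product of
  boxes, and the basis vectors are the \<open>axis i b\<close>, so both volumes are the same double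
  product.\<close>

lemma lborel_vec_eq_PiM:
  "(lborel :: ('a::euclidean_space ^ 'n) measure) =
     distr (\<Pi>\<^sub>M i\<in>UNIV. lborel) borel (\<lambda>f. \<chi> i. f i)"
proof (rule lborel_eqI)
  interpret product_sigma_finite "\<lambda>_::'n. lborel :: 'a measure" ..
  fix l u :: "'a ^ 'n" assume le: "\<And>b. b \<in> Basis \<Longrightarrow> l \<bullet> b \<le> u \<bullet> b"
  have le': "l $ i \<bullet> b \<le> u $ i \<bullet> b" if "b \<in> Basis" for i b
    using le[of "axis i b"] that by (auto simp: inner_axis Basis_vec_def)
  have m: "(\<lambda>f. \<chi> i. f i) \<in> borel_measurable (\<Pi>\<^sub>M i\<in>UNIV::'n set. lborel :: 'a measure)"
    by (rule borel_measurable_vec_lambda) simp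
  have box: "(\<lambda>f. \<chi> i. f i) -` box l u \<inter> space (\<Pi>\<^sub>M i\<in>UNIV::'n set. lborel :: 'a measure)
      = (\<Pi>\<^sub>E i\<in>UNIV. box (l $ i) (u $ i))"
    by (auto simp: box_def space_PiM Basis_vec_def inner_axis PiE_def Pi_def)
  have inj: "inj_on (\<lambda>(i::'n, b::'a). axis i b) (UNIV \<times> Basis)"
    by (auto simp: inj_on_def axis_eq_axis)
  have B: "Basis = (\<lambda>(i::'n, b::'a). axis i b) ` (UNIV \<times> Basis)"
    by (auto simp: Basis_vec_def)
  have "emeasure (distr (\<Pi>\<^sub>M i\<in>UNIV. lborel) borel (\<lambda>f. \<chi> i. f i)) (box l u)
      = (\<Prod>i\<in>UNIV. emeasure lborel (box (l $ i) (u $ i)))"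
    by (simp add: emeasure_distr[OF m] box emeasure_PiM)
  also have "\<dots> = (\<Prod>i\<in>UNIV. ennreal (\<Prod>b\<in>Basis. (u $ i - l $ i) \<bullet> b))"
    using le' by (intro prod.cong refl emeasure_lborel_box) auto
  also have "\<dots> = ennreal (\<Prod>i\<in>UNIV. \<Prod>b\<in>Basis. (u $ i - l $ i) \<bullet> b)"
    using le' by (intro prod_ennreal prod_nonneg) (auto simp: inner_diff_left)
  also have "(\<Prod>i\<in>UNIV. \<Prod>b\<in>Basis. (u $ i - l $ i) \<bullet> b) = (\<Prod>b\<in>Basis. (u - l) \<bullet> b)"
    by (subst B, subst prod.reindex[OF inj])
       (simp add: prod.cartesian_product inner_axis case_prod_unfold)
  finally show "emeasure (distr (\<Pi>\<^sub>M i\<in>UNIV. lborel) borel (\<lambda>f. \<chi> i. f i)) (box l u)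
      = (\<Prod>b\<in>Basis. (u - l) \<bullet> b)" by simp
qed simp

text \<open>The disc of squared radius u has area pi u, which is linear in u. Hence both measures
  agree and are finite on the half-lines \<open>{..u}\<close>, an intersection-stable
  generator.\<close>

lemma distr_lborel_cmod_square:
  "distr lborel borel (\<lambda>z::complex. (cmod z)\<^sup>2) = density lborel (\<lambda>x. ennreal pi * indicator {0..} x)"
proof (rule measure_eqI_generator_eq[where \<Omega>=UNIV and E="range (\<lambda>u::real. {..u})" and A="\<lambda>n. {..real n}"])
  show "Int_stable (range (\<lambda>u::real. {..u}))"
    by (auto simp: Int_stable_def)
  show "sets (distr lborel borel (\<lambda>z::complex. (cmod z)\<^sup>2)) = sigma_sets UNIV (range (\<lambda>u::real. {..u}))"
    by (simp add: borel_eq_atMost)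
  show "sets (density lborel (\<lambda>x::real. ennreal pi * indicator {0..} x)) = sigma_sets UNIV (range (\<lambda>u::real. {..u}))"
    by (simp add: borel_eq_atMost)
  show "(\<Union>n. {..real n}) = UNIV"
    using real_arch_simple by auto
  have L: "emeasure (distr lborel borel (\<lambda>z::complex. (cmod z)\<^sup>2)) {..u} = ennreal (pi * max 0 u)" for u
  proof (cases "u \<ge> 0")
    case True
    have "(\<lambda>z::complex. (cmod z)\<^sup>2) -` {..u} = cball 0 (sqrt u)"
      using True by (auto simp: real_le_rsqrt) (metis abs_norm_cancel real_sqrt_abs real_sqrt_le_iff)
    then show ?thesis
      using True by (simp add: emeasure_distr emeasure_cball unit_ball_vol_2 max_def)
  next
    case False
    then have "(\<lambda>z::complex. (cmod z)\<^sup>2) -` {..u} = {}"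
      by (auto simp: not_le) (meson less_le_trans not_less zero_le_power2)
    with False show ?thesis by (simp add: emeasure_distr)
  qed
  have R: "emeasure (density lborel (\<lambda>x::real. ennreal pi * indicator {0..} x)) {..u} = ennreal (pi * max 0 u)" for u
  proof -
    have "emeasure (density lborel (\<lambda>x::real. ennreal pi * indicator {0..} x)) {..u}
      = (\<integral>\<^sup>+x. ennreal pi * indicator {0..u} x \<partial>lborel)"
      by (subst emeasure_density) (auto intro!: nn_integral_cong simp: indicator_def)
    then show ?thesis
      by (cases "u \<ge> 0") (simp_all add: nn_integral_cmult ennreal_mult max_def)
  qed
  show "emeasure (distr lborel borel (\<lambda>z::complex. (cmod z)\<^sup>2)) X
      = emeasure (density lborel (\<lambda>x::real. ennreal pi * indicator {0..} x)) X"
    if "X \<in> range (\<lambda>u::real. {..u})" for X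
    using that L R by auto
  show "emeasure (distr lborel borel (\<lambda>z::complex. (cmod z)\<^sup>2)) {..real n} \<noteq> \<infinity>" for n
    by (simp add: L)
qed auto

lemma tau2_nth: "tau2 z $ i = (cmod (z $ i))\<^sup>2"
  by (simp add: tau2_def cmod_power2)

lemma measurable_vec_nth_borel [measurable]:
  "(\<lambda>z :: 'a::euclidean_space ^ 'n. z $ i) \<in> borel_measurable borel"
  by (intro borel_measurable_continuous_onI continuous_intros)

lemma borel_measurable_tau2 [measurable]: "tau2 \<in> borel_measurable borel"
  unfolding tau2_def by (rule borel_measurable_vec_lambda) measurable

text \<open>\<open>tau2\<close> acts on each coordinate separately, so the planar case can be
  multiplied up: the n-fold power of \<open>\<rho>\<close> is obtained once as an image of complex
  Lebesgue measure and once as a density on real Lebesgue measure.\<close>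

lemma distr_lborel_tau2:
  "distr lborel borel (tau2 :: complex ^ 'n \<Rightarrow> real ^ 'n) =
     density lborel (\<lambda>y. ennreal (pi ^ CARD('n)) * indicator {y. \<forall>i. 0 \<le> y $ i} y)"
proof -
  define \<rho> where "\<rho> = density lborel (\<lambda>x. ennreal pi * indicator {0..} (x::real))"
  have sig: "sigma_finite_measure \<rho>"
    unfolding \<rho>_def
    by (subst sigma_finite_measure.sigma_finite_iff_density_finite[OF lborel.sigma_finite_measure_axioms])
       (auto simp: indicator_def)
  interpret C: product_sigma_finite "\<lambda>_::'n. lborel :: complex measure" ..
  interpret R: product_sigma_finite "\<lambda>_::'n. lborel :: real measure" ..
  interpret P: product_sigma_finite "\<lambda>_::'n. \<rho>"
    using sig by (rule product_sigma_finite.intro)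
  have s\<rho>[measurable_cong]: "sets \<rho> = sets borel" by (simp add: \<rho>_def)
  have sP[measurable_cong]: "sets (\<Pi>\<^sub>M i\<in>UNIV::'n set. \<rho>) = sets (\<Pi>\<^sub>M i\<in>UNIV::'n set. borel)"
    by (intro sets_PiM_cong refl s\<rho>)
  have v[measurable]: "(\<lambda>f::'n \<Rightarrow> real. \<chi> i. f i) \<in> borel_measurable (\<Pi>\<^sub>M i\<in>UNIV. borel)"
    "(\<lambda>f::'n \<Rightarrow> complex. \<chi> i. f i) \<in> borel_measurable (\<Pi>\<^sub>M i\<in>UNIV. lborel)"
    "(\<lambda>f::'n \<Rightarrow> real. \<chi> i. f i) \<in> borel_measurable (\<Pi>\<^sub>M i\<in>UNIV. lborel)"
    by (rule borel_measurable_vec_lambda, simp)+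
  define sq where "sq = (\<lambda>f::'n \<Rightarrow> complex. \<lambda>i. (cmod (f i))\<^sup>2)"
  have sq[measurable]: "sq \<in> measurable (\<Pi>\<^sub>M i\<in>UNIV. lborel) (\<Pi>\<^sub>M i\<in>UNIV. borel)"
    unfolding sq_def by (rule measurable_PiM_single') auto
  have 1: "distr (\<Pi>\<^sub>M i\<in>UNIV. lborel) (\<Pi>\<^sub>M i\<in>UNIV. \<rho>) sq = (\<Pi>\<^sub>M i\<in>UNIV. \<rho>)"
  proof (rule P.PiM_eqI)
    fix A :: "'n \<Rightarrow> real set" assume A: "\<And>i. i \<in> UNIV \<Longrightarrow> A i \<in> sets \<rho>"
    then have Ab: "A i \<in> sets borel" for i by (simp add: s\<rho>)
    have "sq -` (Pi\<^sub>E UNIV A) \<inter> space (\<Pi>\<^sub>M i\<in>UNIV. lborel) = (\<Pi>\<^sub>E i\<in>UNIV. (\<lambda>z. (cmod z)\<^sup>2) -` A i)"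
      by (auto simp: sq_def space_PiM PiE_def Pi_def)
    then have "emeasure (distr (\<Pi>\<^sub>M i\<in>UNIV. lborel) (\<Pi>\<^sub>M i\<in>UNIV. \<rho>) sq) (Pi\<^sub>E UNIV A)
       = (\<Prod>i\<in>UNIV. emeasure lborel ((\<lambda>z. (cmod z)\<^sup>2) -` A i))"
      using A Ab by (subst emeasure_distr)
        (auto intro!: C.emeasure_PiM sets_PiM_I_finite measurable_sets_borel[OF _ Ab] simp: measurable_cong_sets[OF refl sP])
    also have "\<dots> = (\<Prod>i\<in>UNIV. emeasure (distr lborel borel (\<lambda>z. (cmod z)\<^sup>2)) (A i))"
      using Ab by (intro prod.cong refl) (simp add: emeasure_distr)
    finally show "emeasure (distr (\<Pi>\<^sub>M i\<in>UNIV. lborel) (\<Pi>\<^sub>M i\<in>UNIV. \<rho>) sq) (Pi\<^sub>E UNIV A)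
       = (\<Prod>i\<in>UNIV. emeasure \<rho> (A i))"
      by (simp add: distr_lborel_cmod_square \<rho>_def)
  qed simp_all
  define D where "D = (\<lambda>y::real^'n. ennreal (pi ^ CARD('n)) * indicator {y. \<forall>i. 0 \<le> y $ i} y)"
  have [measurable]: "D \<in> borel_measurable borel" unfolding D_def by measurable
  \<comment> \<open>The orthant indicator factors over the coordinates; a single negative coordinate
    annihilates both sides.\<close>
  have D_prod: "D (\<chi> i. f i) = (\<Prod>i\<in>UNIV. ennreal pi * indicator {0..} (f i))" for f
  proof (cases "\<forall>i. 0 \<le> f i")
    case True then show ?thesis by (simp add: D_def ennreal_power)
  next
    case False
    then obtain j where "\<not> 0 \<le> f j" by auto
    then have "(\<Prod>i\<in>UNIV. ennreal pi * indicator {0..} (f i)) = 0"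
      by (intro prod_zero) (auto intro!: exI[of _ j])
    then show ?thesis using False by (simp add: D_def)
  qed
  have 2: "density (\<Pi>\<^sub>M i\<in>UNIV. lborel) (\<lambda>f. D (\<chi> i. f i)) = (\<Pi>\<^sub>M i\<in>UNIV. \<rho>)"
  proof (rule P.PiM_eqI)
    show "sets (density (\<Pi>\<^sub>M i\<in>UNIV. lborel) (\<lambda>f. D (\<chi> i. f i))) = sets (\<Pi>\<^sub>M i\<in>UNIV. \<rho>)"
      by (simp add: sP cong: sets_PiM_cong)
    fix A :: "'n \<Rightarrow> real set" assume A: "\<And>i. i \<in> UNIV \<Longrightarrow> A i \<in> sets \<rho>"
    then have Ab[measurable]: "A i \<in> sets borel" for i by (simp add: s\<rho>)
    have "emeasure (density (\<Pi>\<^sub>M i\<in>UNIV. lborel) (\<lambda>f. D (\<chi> i. f i))) (Pi\<^sub>E UNIV A)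
      = (\<integral>\<^sup>+f. (\<Prod>i\<in>UNIV. (ennreal pi * indicator {0..} (f i)) * indicator (A i) (f i)) \<partial>(\<Pi>\<^sub>M i\<in>UNIV. lborel))"
    proof (subst emeasure_density)
      have "(\<Prod>i\<in>UNIV. indicator (A i) (f i) :: ennreal) = indicator (Pi\<^sub>E UNIV A) f" for f
        by (auto simp: indicator_def PiE_def Pi_def)
      then show "(\<integral>\<^sup>+f. D (\<chi> i. f i) * indicator (Pi\<^sub>E UNIV A) f \<partial>(\<Pi>\<^sub>M i\<in>UNIV. lborel))
       = (\<integral>\<^sup>+f. (\<Prod>i\<in>UNIV. (ennreal pi * indicator {0..} (f i)) * indicator (A i) (f i)) \<partial>(\<Pi>\<^sub>M i\<in>UNIV. lborel))"
        by (intro nn_integral_cong) (simp add: D_prod prod.distrib)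
    qed (auto intro!: sets_PiM_I_finite)
    also have "\<dots> = (\<Prod>i\<in>UNIV. \<integral>\<^sup>+x. (ennreal pi * indicator {0..} x) * indicator (A i) x \<partial>lborel)"
      by (rule R.product_nn_integral_prod) auto
    also have "\<dots> = (\<Prod>i\<in>UNIV. emeasure \<rho> (A i))"
      unfolding \<rho>_def by (intro prod.cong refl emeasure_density[symmetric]) auto
    finally show "emeasure (density (\<Pi>\<^sub>M i\<in>UNIV. lborel) (\<lambda>f. D (\<chi> i. f i))) (Pi\<^sub>E UNIV A)
      = (\<Prod>i\<in>UNIV. emeasure \<rho> (A i))" .
  qed simp
  have "distr lborel borel (tau2 :: complex ^ 'n \<Rightarrow> real ^ 'n)
      = distr (\<Pi>\<^sub>M i\<in>UNIV. lborel) borel (\<lambda>f. tau2 (\<chi> i. f i))"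
    by (subst lborel_vec_eq_PiM) (simp add: distr_distr comp_def)
  also have "\<dots> = distr (distr (\<Pi>\<^sub>M i\<in>UNIV. lborel) (\<Pi>\<^sub>M i\<in>UNIV. \<rho>) sq) borel (\<lambda>f. \<chi> i. f i)"
    by (subst distr_distr)
      (auto simp: comp_def vec_eq_iff tau2_nth measurable_cong_sets[OF refl sP] sq intro!: distr_cong,
       simp add: sq_def)
  also have "\<dots> = distr (density (\<Pi>\<^sub>M i\<in>UNIV. lborel) (\<lambda>f. D (\<chi> i. f i))) borel (\<lambda>f. \<chi> i. f i)"
    by (simp only: 1 2)
  also have "\<dots> = density (distr (\<Pi>\<^sub>M i\<in>UNIV. lborel) borel (\<lambda>f. \<chi> i. f i)) D"
    by (rule density_distr[symmetric]) auto
  finally show ?thesis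
    by (simp add: lborel_vec_eq_PiM[symmetric] D_def)
qed

text \<open>The factor c cancels in the normalization. Allowing it covers both isometries (c = 1)
  and \<open>tau2\<close> (c = pi^n).\<close>

lemma distr_uniform_measure:
  assumes [measurable]: "f \<in> measurable M N" "K \<in> sets M" and "S \<in> sets N"
    and "c \<noteq> 0" "c \<noteq> \<infinity>"
    and eq: "\<And>A. A \<in> sets N \<Longrightarrow> emeasure M (K \<inter> f -` A) = c * emeasure N (S \<inter> A)"
    and K: "K \<subseteq> f -` S"
  shows "distr (uniform_measure M K) N f = uniform_measure N S"
proof (rule measure_eqI)
  fix A assume "A \<in> sets (distr (uniform_measure M K) N f)"
  then have A[measurable]: "A \<in> sets N" by simp
  have vol: "emeasure M K = c * emeasure N S"
    using eq[OF \<open>S \<in> sets N\<close>] K by (simp add: Int_absorb2)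
  have "emeasure (distr (uniform_measure M K) N f) A = emeasure M (K \<inter> (f -` A \<inter> space M)) / emeasure M K"
    by (simp add: emeasure_distr)
  also have "K \<inter> (f -` A \<inter> space M) = K \<inter> f -` A"
    using sets.sets_into_space[OF \<open>K \<in> sets M\<close>] by auto
  also have "emeasure M (K \<inter> f -` A) / emeasure M K = emeasure N (S \<inter> A) / emeasure N S"
    unfolding vol eq[OF A] using \<open>c \<noteq> 0\<close> \<open>c \<noteq> \<infinity>\<close>
    by (simp add: mult.commute[of c] divide_mult_eq)
  finally show "emeasure (distr (uniform_measure M K) N f) A = emeasure (uniform_measure N S) A"
    using \<open>S \<in> sets N\<close> by simp
qed simp

section \<open>The surface measure of the sphere and its image on the simplex\<close>

lemma sets_sphere_measure [simp, measurable_cong]: "sets sphere_measure = sets borel"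
  by (simp add: sphere_measure_def)

lemma space_sphere_measure [simp]: "space sphere_measure = UNIV"
  by (simp add: sphere_measure_def)

lemma prob_space_sphere_measure: "prob_space sphere_measure"
  unfolding sphere_measure_def
  by (intro prob_space.prob_space_distr prob_space_uniform_measure emeasure_lborel_cball_bounds)
     measurable

text \<open>The measure lives on the whole vector space. Radial projection misses the sphere only at
  the origin, where division by zero returns 0, and that point is null.\<close>

lemma AE_sphere_measure_norm: "AE z in sphere_measure. norm z = 1"
proof -
  have "AE z in uniform_measure lborel (cball 0 1 :: (complex ^ 'n) set). norm (z /\<^sub>R norm z) = 1"
    using AE_lborel_singleton[of "0::complex^'n"]
    by (intro AE_uniform_measureI) (auto elim!: eventually_mono)
  then show ?thesis
    unfolding sphere_measure_def by (subst AE_distr_iff) auto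
qed

text \<open>A linear isometry preserves the uniform measure of the ball and commutes with radial
  projection.\<close>

lemma sphere_measure_distr_linear_isometry:
  fixes T :: "complex ^ 'n \<Rightarrow> complex ^ 'n"
  assumes T: "linear T" and iso: "\<And>x. norm (T x) = norm x"
  shows "distr sphere_measure borel T = sphere_measure"
proof -
  have m[measurable]: "T \<in> borel_measurable borel"
    using T by (simp add: linear_continuous_on linear_linear borel_measurable_continuous_onI)
  have "emeasure lborel (cball 0 1 \<inter> T -` A) = emeasure lborel (cball 0 1 \<inter> A)"
    if [measurable]: "A \<in> sets lborel" for A
  proof -
    have "T -` (cball 0 1 \<inter> A) = cball 0 1 \<inter> T -` A"
      by (auto simp: iso)
    moreover have "cball 0 1 \<inter> A \<in> sets borel"
      using that by simp
    ultimately have "emeasure (distr lborel borel T) (cball 0 1 \<inter> A) = emeasure lborel (cball 0 1 \<inter> T -` A)"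
      by (simp add: emeasure_distr)
    then show ?thesis by (simp add: lborel_distr_linear_isometry[OF assms])
  qed
  then have u: "distr (uniform_measure lborel (cball 0 1)) lborel T = uniform_measure lborel (cball 0 1)"
    by (intro distr_uniform_measure[where c=1]) (auto simp: iso)
  have "distr sphere_measure borel T
      = distr (uniform_measure lborel (cball 0 1)) borel (\<lambda>z. T (z /\<^sub>R norm z))"
    by (simp add: sphere_measure_def distr_distr comp_def)
  also have "\<dots> = distr (uniform_measure lborel (cball 0 1)) borel (\<lambda>z. T z /\<^sub>R norm (T z))"
    by (simp add: linear_scale[OF T] iso)
  also have "\<dots> = distr (distr (uniform_measure lborel (cball 0 1)) lborel T) borel (\<lambda>z. z /\<^sub>R norm z)"
    by (simp add: distr_distr comp_def)
  finally show ?thesis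
    by (simp add: u sphere_measure_def)
qed

lemma sum_tau2: "(\<Sum>i\<in>UNIV. tau2 z $ i) = (norm z)\<^sup>2"
  by (simp add: tau2_nth norm_vec_def L2_set_def sum_nonneg)

lemma tau2_scaleR: "tau2 (r *\<^sub>R z) = r\<^sup>2 *\<^sub>R tau2 z"
  by (simp add: vec_eq_iff tau2_nth power_mult_distrib)

text \<open>The ball is the full preimage of the pyramid under \<open>tau2\<close>, with constant
  density. As \<open>tau2\<close> is homogeneous of degree 2 and its coordinates sum to the squared
  norm, it intertwines the radial projections that define the two measures.\<close>

lemma distr_sphere_measure_tau2: 
  "distr sphere_measure borel tau2 = (simplex_measure :: (real ^ 'n) measure)"
proof -
  let ?S = "{y::real^'n. (\<forall>i. 0 \<le> y $ i) \<and> (\<Sum>i\<in>UNIV. y $ i) \<le> 1}"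
  have [measurable]: "?S \<in> sets borel" by measurable
  have K: "cball 0 1 = tau2 -` ?S"
    by (auto simp: sum_tau2 abs_square_le_1) (simp add: tau2_nth)
  have "emeasure lborel (cball 0 1 \<inter> tau2 -` A) = ennreal (pi ^ CARD('n)) * emeasure lborel (?S \<inter> A)"
    if [measurable]: "A \<in> sets lborel" for A :: "(real^'n) set"
  proof -
    have [measurable]: "A \<in> sets borel" using that by simp
    have "emeasure lborel (cball 0 1 \<inter> tau2 -` A) = emeasure (distr lborel borel tau2) (?S \<inter> A)"
      by (simp add: emeasure_distr K)
    also have "\<dots> = (\<integral>\<^sup>+y. ennreal (pi ^ CARD('n)) * indicator (?S \<inter> A) y \<partial>lborel)"
      unfolding distr_lborel_tau2
      by (subst emeasure_density) (auto intro!: nn_integral_cong simp: indicator_def)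
    finally show ?thesis by (simp add: nn_integral_cmult)
  qed
  then have u: "distr (uniform_measure lborel (cball 0 1)) lborel tau2 = uniform_measure lborel ?S"
    by (intro distr_uniform_measure[where c="ennreal (pi ^ CARD('n))"]) (auto simp: K)
  have [measurable]: "(\<lambda>y::real^'n. y /\<^sub>R (\<Sum>i\<in>UNIV. y $ i)) \<in> borel_measurable borel"
    by measurable
  have "distr sphere_measure borel tau2
      = distr (uniform_measure lborel (cball 0 1)) borel (\<lambda>z::complex^'n. tau2 (z /\<^sub>R norm z))"
    by (simp add: sphere_measure_def distr_distr comp_def)
  also have "\<dots> = distr (uniform_measure lborel (cball 0 1)) borel (\<lambda>z. tau2 z /\<^sub>R (\<Sum>i\<in>UNIV. tau2 z $ i))"
    by (simp add: tau2_scaleR sum_tau2 power_inverse)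
  also have "\<dots> = distr (distr (uniform_measure lborel (cball 0 1)) lborel tau2) borel (\<lambda>y. y /\<^sub>R (\<Sum>i\<in>UNIV. y $ i))"
    by (simp add: distr_distr comp_def)
  finally show ?thesis
    by (simp add: u simplex_measure_def)
qed

section \<open>Moments of unitarily invariant measures\<close>

definition bimonom :: "('n \<Rightarrow> nat) \<Rightarrow> ('n \<Rightarrow> nat) \<Rightarrow> complex ^ 'n \<Rightarrow> complex" where
  "bimonom a b z = (\<Prod>i\<in>UNIV. (z $ i) ^ a i * cnj (z $ i) ^ b i)"

lemma continuous_on_bimonom [continuous_intros]:
  "continuous_on A f \<Longrightarrow> continuous_on A (\<lambda>x. bimonom a b (f x))"
  unfolding bimonom_def by (intro continuous_intros)

text \<open>This is the eigenfunction property: multiplication by a torus element g scales the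
  monomial by \<open>bimonom a b g\<close>.\<close>

lemma bimonom_mult: "bimonom a b (g * z) = bimonom a b g * bimonom a b z"
  by (simp add: bimonom_def power_mult_distrib prod.distrib ac_simps)

lemma bimonom_scale: "bimonom a b (c *s z) = c ^ sum a UNIV * cnj c ^ sum b UNIV * bimonom a b z"
  by (simp add: bimonom_def power_mult_distrib prod.distrib power_sum ac_simps)

text \<open>The monomials that survive averaging over the full torus are those that descend to the
  simplex, with half the degree.\<close>

lemma bimonom_diag: "bimonom a a z = of_real (\<Prod>i\<in>UNIV. (tau2 z $ i) ^ a i)"
proof -
  have "x ^ k * cnj x ^ k = of_real (((cmod x)\<^sup>2) ^ k)" for x k
    by (metis complex_norm_square of_real_power power_mult_distrib)
  then show ?thesis by (simp add: bimonom_def tau2_nth)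
qed

lemma unit_power_mult_cnj_power:
  assumes "cmod c = 1"
  shows "c ^ m * cnj c ^ n = c powi (int m - int n)"
proof -
  have "c \<noteq> 0" using assms by auto
  have "cnj c = inverse c"
    using assms complex_norm_square[of c] by (intro inverse_unique[symmetric]) simp
  then show ?thesis
    using \<open>c \<noteq> 0\<close> by (simp add: power_int_diff power_inverse divide_inverse)
qed

lemma bimonom_torus:
  assumes "g \<in> torus_set"
  shows "bimonom a b g = (\<Prod>i\<in>UNIV. (g $ i) powi (int (a i) - int (b i)))"
  using assms by (simp add: bimonom_def torus_set_def unit_power_mult_cnj_power)

lemma bimonom_phase:
  assumes "sum a UNIV = sum b UNIV" "cmod c = 1"
  shows "bimonom a b (c *s z) = bimonom a b z"
  using assms by (simp add: bimonom_scale unit_power_mult_cnj_power)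

text \<open>The value -1 is convenient because invariance of an integral I then reads I = - I, so I
  vanishes.\<close>

lemma ex_unit_powi_eq_minus_1:
  assumes "k \<noteq> 0"
  shows "\<exists>c. cmod c = 1 \<and> c powi k = -1"
  using assms by (intro exI[of _ "cis (pi / of_int k)"]) (simp add: cis_power_int)

lemma ex_torus_bimonom_eq_minus_1:
  assumes "a \<noteq> (b :: 'n::finite \<Rightarrow> nat)"
  shows "\<exists>g\<in>torus_set. bimonom a b g = -1"
proof -
  obtain i where i: "a i \<noteq> b i" using assms by auto
  then obtain c where c: "cmod c = 1" "c powi (int (a i) - int (b i)) = -1"
    using ex_unit_powi_eq_minus_1[of "int (a i) - int (b i)"] by auto
  define g where "g = (\<chi> k. if k = i then c else 1)"
  have "g \<in> torus_set" using c by (simp add: g_def torus_set_def)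
  moreover have "bimonom a b g = (\<Prod>k\<in>UNIV. if k = i then -1 else 1)"
    unfolding bimonom_torus[OF \<open>g \<in> torus_set\<close>]
    by (intro prod.cong) (auto simp: g_def c)
  ultimately show ?thesis by (auto simp: prod.delta)
qed

section \<open>Diagonal unitaries and plane rotations\<close>

definition diag_matrix :: "complex ^ 'n \<Rightarrow> complex ^ 'n ^ 'n" where
  "diag_matrix g = (\<chi> k l. if k = l then g $ k else 0)"

lemma diag_matrix_mult_vec: "diag_matrix g *v z = g * z"
  by (simp add: diag_matrix_def matrix_vector_mult_def vec_eq_iff if_distrib[of "\<lambda>x. x * _"] sum.delta cong: if_cong)

lemma matrix_mult_eq_mat_1I:
  fixes A B :: "'a::comm_semiring_1 ^ 'n ^ 'n"
  assumes "\<And>z. A *v (B *v z) = z"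
  shows "A ** B = mat 1"
  using assms by (subst matrix_eq) (simp add: matrix_vector_mul_assoc[symmetric])

lemma unitary_diag_matrix:
  assumes "g \<in> torus_set"
  shows "unitary_matrix (diag_matrix g)"
proof -
  have tr: "(\<chi> i j. cnj (diag_matrix g $ j $ i)) = diag_matrix (\<chi> i. cnj (g $ i))"
    by (simp add: diag_matrix_def vec_eq_iff)
  have "g $ k * cnj (g $ k) = 1" for k
    using assms complex_norm_square[of "g $ k"] by (simp add: torus_set_def)
  then have cancel: "cnj (g $ k) * (g $ k * x) = x" "g $ k * (cnj (g $ k) * x) = x" for k x
    by (metis mult.assoc mult.commute mult_1)+
  show ?thesis
    unfolding unitary_matrix_def tr
    by (intro conjI matrix_mult_eq_mat_1I) (simp_all add: diag_matrix_mult_vec vec_eq_iff cancel)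
qed

definition rotation_matrix :: "'n \<Rightarrow> 'n \<Rightarrow> real \<Rightarrow> real \<Rightarrow> complex ^ 'n ^ 'n" where
  "rotation_matrix i j c s = (\<chi> k l.
     if k = i then (if l = i then of_real c else if l = j then of_real s else 0)
     else if k = j then (if l = i then - of_real s else if l = j then of_real c else 0)
     else (if l = k then 1 else 0))"

lemma rotation_matrix_mult_vec:
  assumes "i \<noteq> j"
  shows "rotation_matrix i j c s *v z = (\<chi> k. if k = i then of_real c * z $ i + of_real s * z $ j
     else if k = j then of_real c * z $ j - of_real s * z $ i else z $ k)"
proof -
  have two: "(\<Sum>l\<in>UNIV. (if l = i then x else if l = j then y else 0) * z $ l) = x * z $ i + y * z $ j" for x y
  proof -
    have "(\<Sum>l\<in>UNIV. (if l = i then x else if l = j then y else 0) * z $ l)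
        = (\<Sum>l\<in>UNIV. (if l = i then x * z $ l else 0) + (if l = j then y * z $ l else 0))"
      using assms by (intro sum.cong) auto
    then show ?thesis by (simp add: sum.distrib)
  qed
  have one: "(\<Sum>l\<in>UNIV. (if l = k then 1 else 0) * z $ l) = z $ k" for k
    by (simp add: if_distrib[of "\<lambda>x. x * _"] cong: if_cong)
  show ?thesis
    using assms by (auto simp: rotation_matrix_def matrix_vector_mult_def vec_eq_iff two one)
qed

lemma unitary_rotation_matrix:
  assumes "i \<noteq> j" "c\<^sup>2 + s\<^sup>2 = 1"
  shows "unitary_matrix (rotation_matrix i j c s)"
proof -
  have tr: "(\<chi> k l. cnj (rotation_matrix i j c s $ l $ k)) = rotation_matrix i j c (- s)"
    using assms(1) by (auto simp: rotation_matrix_def vec_eq_iff)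
  let ?c = "complex_of_real c" and ?s = "complex_of_real s"
  have "?c * ?c + ?s * ?s = 1"
    using assms(2) by (simp add: power2_eq_square flip: of_real_mult of_real_add)
  then have cs: "?c * (?c * x - ?s * y) + ?s * (?c * y + ?s * x) = x"
    "?c * (?c * x + ?s * y) - ?s * (?c * y - ?s * x) = x" for x y
    by algebra+
  show ?thesis
    using assms(1) unfolding unitary_matrix_def tr
    by (intro conjI matrix_mult_eq_mat_1I) (simp_all add: rotation_matrix_mult_vec vec_eq_iff cs)
qed

lemma bimonom_split_two:
  assumes "i \<noteq> j"
  shows "bimonom a b z = z $ i ^ a i * cnj (z $ i) ^ b i * (z $ j ^ a j * cnj (z $ j) ^ b j)
    * (\<Prod>k\<in>UNIV - {i, j}. z $ k ^ a k * cnj (z $ k) ^ b k)"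
proof -
  have "(\<Prod>k\<in>UNIV. z $ k ^ a k * cnj (z $ k) ^ b k)
    = (\<Prod>k\<in>{i, j}. z $ k ^ a k * cnj (z $ k) ^ b k) * (\<Prod>k\<in>UNIV - {i, j}. z $ k ^ a k * cnj (z $ k) ^ b k)"
    by (subst prod.subset_diff[of "{i, j}"]) (auto simp: mult.commute)
  then show ?thesis using assms by (simp add: bimonom_def)
qed

text \<open>With no power of coordinate j present, the rotation expands by a single binomial theorem
  for z and one for its conjugate. Every way of sharing the exponent p between i and j occurs among
  the terms.\<close>

lemma bimonom_rotation:
  assumes "i \<noteq> j" and B: "B i = p" "B j = 0"
  shows "bimonom B B (rotation_matrix i j c s *v z) =
    (\<Sum>q\<le>p. \<Sum>r\<le>p. of_real (of_nat (p choose q) * of_nat (p choose r) * (c ^ (p - q) * c ^ (p - r) * s ^ q * s ^ r))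
       * bimonom (B(i := p - q, j := q)) (B(i := p - r, j := r)) z)"
proof -
  define W where "W = (\<Prod>k\<in>UNIV - {i, j}. z $ k ^ B k * cnj (z $ k) ^ B k)"
  have bin: "(of_real c * z $ i + of_real s * z $ j) ^ p
      = (\<Sum>q\<le>p. of_nat (p choose q) * (of_real s * z $ j) ^ q * (of_real c * z $ i) ^ (p - q))"
    by (subst add.commute) (rule binomial_ring)
  have "bimonom B B (rotation_matrix i j c s *v z) =
     (of_real c * z $ i + of_real s * z $ j) ^ p * cnj ((of_real c * z $ i + of_real s * z $ j) ^ p) * W"
    using assms by (simp add: bimonom_split_two[OF \<open>i \<noteq> j\<close>] rotation_matrix_mult_vec W_def)
  also have "\<dots> = (\<Sum>q\<le>p. \<Sum>r\<le>p. (of_nat (p choose q) * (of_real s * z $ j) ^ q * (of_real c * z $ i) ^ (p - q))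
     * (of_nat (p choose r) * (of_real s * cnj (z $ j)) ^ r * (of_real c * cnj (z $ i)) ^ (p - r)) * W)"
    unfolding bin cnj_sum unfolding sum_product unfolding sum_distrib_right by simp
  also have "\<dots> = (\<Sum>q\<le>p. \<Sum>r\<le>p. of_real (of_nat (p choose q) * of_nat (p choose r) * (c ^ (p - q) * c ^ (p - r) * s ^ q * s ^ r))
       * bimonom (B(i := p - q, j := q)) (B(i := p - r, j := r)) z)"
    using assms
    by (intro sum.cong refl)
       (simp add: bimonom_split_two[OF \<open>i \<noteq> j\<close>] W_def power_mult_distrib ac_simps)
  finally show ?thesis .
qed

text \<open>Functions on the sphere that are invariant under scalar phases are exactly those that descend to
  projective space, so the locale covers the sphere and projective space at once.\<close>

definition phase_invariant :: "(complex ^ 'n \<Rightarrow> complex) \<Rightarrow> bool" where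
  "phase_invariant f \<longleftrightarrow> continuous_on UNIV f \<and> (\<forall>c z. cmod c = 1 \<longrightarrow> f (c *s z) = f z)"

lemma phase_invariant_bimonom: "sum a UNIV = sum b UNIV \<Longrightarrow> phase_invariant (bimonom a b)"
  by (auto simp: phase_invariant_def bimonom_phase intro!: continuous_intros)

section \<open>Integrability and the moment recursion\<close>

lemma ex_bound_on_sphere:
  fixes f :: "complex ^ 'n \<Rightarrow> complex"
  assumes "continuous_on UNIV f"
  shows "\<exists>B. \<forall>z. norm z = 1 \<longrightarrow> norm (f z) \<le> B"
proof -
  have "compact (f ` sphere 0 1)"
    using assms by (intro compact_continuous_image) (auto intro: continuous_on_subset)
  then obtain B where "\<forall>w\<in>f ` sphere 0 1. norm w \<le> B"
    using compact_imp_bounded bounded_iff by metis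
  then show ?thesis by (intro exI[of _ B]) auto
qed

lemma integral_sum_sum_mult:
  fixes F :: "nat \<Rightarrow> nat \<Rightarrow> 'b \<Rightarrow> complex"
  assumes "\<And>q r. q \<le> p \<Longrightarrow> r \<le> p \<Longrightarrow> integrable M (F q r)"
  shows "(\<integral>x. (\<Sum>q\<le>p. \<Sum>r\<le>p. k q r * F q r x) \<partial>M) = (\<Sum>q\<le>p. \<Sum>r\<le>p. k q r * (\<integral>x. F q r x \<partial>M))"
proof -
  have "(\<integral>x. (\<Sum>r\<le>p. k q r * F q r x) \<partial>M) = (\<Sum>r\<le>p. k q r * (\<integral>x. F q r x \<partial>M))" if "q \<le> p" for q
    using assms that by (subst Bochner_Integration.integral_sum) auto
  then show ?thesis
    using assms by (subst Bochner_Integration.integral_sum) auto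
qed

text \<open>\<open>\<zeta>\<close> is the identity for the sphere and \<open>unit_rep\<close> for
  projective space. As \<open>unit_rep\<close> is an arbitrary choice, measurability and invariance
  are asked only after composition with functions that do not see the choice of phase.\<close>

locale unitary_moments = prob_space N for N :: "'b measure" +
  fixes \<zeta> :: "'b \<Rightarrow> complex ^ 'n"
  assumes AE_norm: "AE x in N. norm (\<zeta> x) = 1"
    and measurable_inv: "phase_invariant f \<Longrightarrow> (\<lambda>x. f (\<zeta> x)) \<in> borel_measurable N"
    and unitary_inv: "phase_invariant f \<Longrightarrow> unitary_matrix U \<Longrightarrow>
      (\<integral>x. f (U *v \<zeta> x) \<partial>N) = (\<integral>x. f (\<zeta> x) \<partial>N)"
begin

lemma integrable_inv:
  assumes "phase_invariant f"
  shows "integrable N (\<lambda>x. f (\<zeta> x))"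
proof -
  obtain B where B: "\<And>z. norm z = 1 \<Longrightarrow> norm (f z) \<le> B"
    using ex_bound_on_sphere[of f] assms by (auto simp: phase_invariant_def)
  show ?thesis
    using AE_norm B by (intro integrable_const_bound[where B=B] measurable_inv assms) auto
qed

definition moment :: "('n \<Rightarrow> nat) \<Rightarrow> complex" where
  "moment b = (\<integral>x. bimonom b b (\<zeta> x) \<partial>N)"

lemma integrable_bimonom: "sum a UNIV = sum b UNIV \<Longrightarrow> integrable N (\<lambda>x. bimonom a b (\<zeta> x))"
  by (intro integrable_inv phase_invariant_bimonom)

lemma integral_bimonom_off_diag:
  assumes "sum a UNIV = sum b UNIV" "a \<noteq> b"
  shows "(\<integral>x. bimonom a b (\<zeta> x) \<partial>N) = 0"
proof -
  obtain g where g: "g \<in> torus_set" "bimonom a b g = -1"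
    using ex_torus_bimonom_eq_minus_1[OF assms(2)] by auto
  have "(\<integral>x. bimonom a b (\<zeta> x) \<partial>N) = (\<integral>x. bimonom a b (diag_matrix g *v \<zeta> x) \<partial>N)"
    using assms g by (intro unitary_inv[symmetric] phase_invariant_bimonom unitary_diag_matrix)
  also have "\<dots> = - (\<integral>x. bimonom a b (\<zeta> x) \<partial>N)"
    by (simp add: diag_matrix_mult_vec bimonom_mult g)
  finally show ?thesis by simp
qed

text \<open>In the expanded square only the terms with r = q are diagonal; the others integrate to
  0. This leaves squared binomial coefficients and even powers of c and s.\<close>

lemma moment_rotation:
  assumes "i \<noteq> j" and B: "B i = p" "B j = 0" and cs: "c\<^sup>2 + s\<^sup>2 = 1"
  shows "(\<Sum>q\<le>p. of_real ((of_nat (p choose q))\<^sup>2 * ((c\<^sup>2) ^ (p - q) * (s\<^sup>2) ^ q)) * moment (B(i := p - q, j := q))) = moment B"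
proof -
  have deg: "sum (B(i := p - q, j := q)) UNIV = sum B UNIV" if "q \<le> p" for q
  proof -
    have split: "sum f UNIV = sum f (UNIV - {i, j}) + (f i + f j)" for f :: "'n \<Rightarrow> nat"
      using assms(1) by (subst sum.subset_diff[of "{i, j}"]) auto
    show ?thesis
      unfolding split[of B] split[of "B(i := p - q, j := q)"] using assms that
      by (auto intro!: sum.cong)
  qed
  have E: "(\<integral>x. bimonom (B(i := p - q, j := q)) (B(i := p - r, j := r)) (\<zeta> x) \<partial>N)
     = (if r = q then moment (B(i := p - q, j := q)) else 0)" if "q \<le> p" "r \<le> p" for q r
  proof (cases "r = q")
    case False
    then have "B(i := p - q, j := q) \<noteq> B(i := p - r, j := r)"
      by (metis fun_upd_same)
    then show ?thesis using False that deg by (simp add: integral_bimonom_off_diag)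
  qed (simp add: moment_def)
  have int: "integrable N (\<lambda>x. bimonom (B(i := p - q, j := q)) (B(i := p - r, j := r)) (\<zeta> x))"
    if "q \<le> p" "r \<le> p" for q r
    using deg that by (intro integrable_bimonom) metis
  have "moment B = (\<integral>x. bimonom B B (rotation_matrix i j c s *v \<zeta> x) \<partial>N)"
    unfolding moment_def
    by (intro unitary_inv[symmetric] phase_invariant_bimonom unitary_rotation_matrix assms refl)
  also have "\<dots> = (\<Sum>q\<le>p. \<Sum>r\<le>p. of_real (of_nat (p choose q) * of_nat (p choose r) * (c ^ (p - q) * c ^ (p - r) * s ^ q * s ^ r))
       * (\<integral>x. bimonom (B(i := p - q, j := q)) (B(i := p - r, j := r)) (\<zeta> x) \<partial>N))"
    unfolding bimonom_rotation[OF assms(1-3)]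
    by (rule integral_sum_sum_mult) (rule int)
  also have "\<dots> = (\<Sum>q\<le>p. of_real (of_nat (p choose q) * of_nat (p choose q) * (c ^ (p - q) * c ^ (p - q) * s ^ q * s ^ q))
       * moment (B(i := p - q, j := q)))"
    by (intro sum.cong refl) (simp add: E if_distrib[of "\<lambda>x. _ * x"] sum.delta cong: if_cong)
  also have "\<dots> = (\<Sum>q\<le>p. of_real ((of_nat (p choose q))\<^sup>2 * ((c\<^sup>2) ^ (p - q) * (s\<^sup>2) ^ q)) * moment (B(i := p - q, j := q)))"
    by (intro sum.cong refl) (simp add: power2_eq_square power_mult_distrib ac_simps)
  finally show ?thesis by simp
qed

text \<open>With \<open>x = (s/c)\<^sup>2\<close>, the identity of \<open>moment_rotation\<close> becomes an equality of two polynomials in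
  \<open>x\<close> for all positive \<open>x\<close>; compare coefficients.\<close>

lemma moment_binomial:
  assumes "i \<noteq> j" and B: "B i = p" "B j = 0" and "q \<le> p"
  shows "of_nat (p choose q) * moment (B(i := p - q, j := q)) = moment B"
proof -
  \<comment> \<open>\<open>d q\<close> is the coefficient of x^q after multiplication by (1 + x)^p,
    the right-hand side being expanded by the binomial theorem.\<close>
  define d where "d q = (of_nat (p choose q))\<^sup>2 * moment (B(i := p - q, j := q)) - of_nat (p choose q) * moment B" for q
  have root: "(\<Sum>q\<le>p. d q * of_real x ^ q) = 0" if "x > 0" for x
  proof -
    \<comment> \<open>The choice gives c^2 = 1/(1+x) and s^2 = x/(1+x), so that all terms share the
      denominator (1+x)^p.\<close>
    define c where "c = 1 / sqrt (1 + x)"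
    define s where "s = sqrt x / sqrt (1 + x)"
    have c2: "c\<^sup>2 = 1 / (1 + x)" and s2: "s\<^sup>2 = x / (1 + x)"
      using that by (simp_all add: c_def s_def power_divide)
    have "c\<^sup>2 + s\<^sup>2 = 1"
      using that by (simp add: c2 s2 add_divide_distrib[symmetric])
    from moment_rotation[OF assms(1-3) this]
    have *: "(\<Sum>q\<le>p. of_real ((of_nat (p choose q))\<^sup>2 * ((c\<^sup>2) ^ (p - q) * (s\<^sup>2) ^ q)) * moment (B(i := p - q, j := q))) = moment B" .
    have cs: "(c\<^sup>2) ^ (p - q) * (s\<^sup>2) ^ q = x ^ q / (1 + x) ^ p" if "q \<le> p" for q
      using that by (simp add: c2 s2 power_divide power_add[symmetric])
    have "(\<Sum>q\<le>p. of_real ((of_nat (p choose q))\<^sup>2 * (x ^ q / (1 + x) ^ p)) * moment (B(i := p - q, j := q))) = moment B"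
      by (subst *[symmetric]) (intro sum.cong, auto simp: cs)
    then have "of_real ((1 + x) ^ p) * (\<Sum>q\<le>p. of_real ((of_nat (p choose q))\<^sup>2 * (x ^ q / (1 + x) ^ p)) * moment (B(i := p - q, j := q)))
       = of_real ((1 + x) ^ p) * moment B" by simp
    moreover have "of_real ((1 + x) ^ p) * (\<Sum>q\<le>p. of_real ((of_nat (p choose q))\<^sup>2 * (x ^ q / (1 + x) ^ p)) * moment (B(i := p - q, j := q)))
       = (\<Sum>q\<le>p. of_real (x ^ q) * ((of_nat (p choose q))\<^sup>2 * moment (B(i := p - q, j := q))))"
    proof -
      have "of_real ((1 + x) ^ p) * (of_real ((of_nat (p choose q))\<^sup>2 * (x ^ q / (1 + x) ^ p)) * m)
        = of_real (x ^ q) * ((of_nat (p choose q))\<^sup>2 * m)" for q and m :: complex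
      proof -
        have "(1 + x) ^ p * ((of_nat (p choose q))\<^sup>2 * (x ^ q / (1 + x) ^ p)) = x ^ q * (of_nat (p choose q))\<^sup>2"
          using that by simp
        then have "of_real ((1 + x) ^ p) * (of_real ((of_nat (p choose q))\<^sup>2 * (x ^ q / (1 + x) ^ p)) * m)
          = of_real (x ^ q * (of_nat (p choose q))\<^sup>2) * m"
          by (simp only: mult.assoc[symmetric] of_real_mult[symmetric])
        then show ?thesis by (simp only: of_real_mult of_real_power of_real_of_nat_eq mult.assoc)
      qed
      then show ?thesis by (simp only: sum_distrib_left)
    qed
    moreover have "of_real ((1 + x) ^ p) = (\<Sum>q\<le>p. of_real (x ^ q) * (of_nat (p choose q) :: complex))"
      by (subst add.commute, subst binomial_ring) (simp add: mult.commute)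
    ultimately have "(\<Sum>q\<le>p. of_real (x ^ q) * ((of_nat (p choose q))\<^sup>2 * moment (B(i := p - q, j := q))))
      = (\<Sum>q\<le>p. of_real (x ^ q) * of_nat (p choose q)) * moment B" by metis
    then show ?thesis
      by (simp add: d_def algebra_simps sum_subtractf sum_distrib_left sum_distrib_right)
  qed
  have "infinite (complex_of_real ` {0<..})"
    by (subst finite_image_iff) (auto simp: inj_on_def infinite_Ioi)
  moreover have "complex_of_real ` {0<..} \<subseteq> {z. (\<Sum>q\<le>p. d q * z ^ q) = 0}"
    using root by auto
  ultimately have "infinite {z. (\<Sum>q\<le>p. d q * z ^ q) = 0}"
    using finite_subset by blast
  then have "d q = 0"
    using polyfun_finite_roots[of d p] \<open>q \<le> p\<close> by blast
  moreover have "(of_nat (p choose q) :: complex) \<noteq> 0"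
    using \<open>q \<le> p\<close> by simp
  ultimately show ?thesis by (simp add: d_def power2_eq_square)
qed

text \<open>Both raised exponents arise from one B, in which coordinate i carries the total p = b_i
  + b_j + 1 and coordinate j nothing. Each moment is that of B divided by a binomial coefficient,
  and neighbouring coefficients have ratio (b_i + 1)/(b_j + 1) because p - b_j = b_i + 1.\<close>

lemma moment_exchange:
  "of_nat (Suc (b j)) * moment (b(i := Suc (b i))) = of_nat (Suc (b i)) * moment (b(j := Suc (b j)))"
proof (cases "i = j")
  case False
  have cancel: "C * (n * e) = C * (m * e')" if "C * e = M" "C' * e' = M" "n * C' = m * C"
    for C C' n m e e' M :: complex
    using that by (metis mult.assoc mult.left_commute)
  define p where "p = Suc (b i + b j)"
  have "(of_nat (p choose b j) :: complex) \<noteq> 0"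
    by (simp add: p_def)
  define B where "B = b(i := p, j := 0)"
  have B: "B i = p" "B j = 0" using False by (auto simp: B_def)
  have "B(i := p - b j, j := b j) = b(i := Suc (b i))" "B(i := p - Suc (b j), j := Suc (b j)) = b(j := Suc (b j))"
    using False by (auto simp: B_def p_def fun_eq_iff)
  then have "of_nat (p choose b j) * moment (b(i := Suc (b i))) = moment B"
    "of_nat (p choose Suc (b j)) * moment (b(j := Suc (b j))) = moment B"
    using moment_binomial[OF False B, of "b j"] moment_binomial[OF False B, of "Suc (b j)"]
    by (auto simp: p_def)
  moreover have "Suc (b j) * (p choose Suc (b j)) = Suc (b i) * (p choose b j)"
    using binomial_absorb_comp[of p "b j"] binomial_absorption[of "b j" p]
    by (simp add: p_def Suc_diff_le)
  then have "of_nat (Suc (b j)) * of_nat (p choose Suc (b j)) = (of_nat (Suc (b i)) * of_nat (p choose b j) :: complex)"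
    unfolding of_nat_mult[symmetric] by (rule arg_cong)
  ultimately have "of_nat (p choose b j) * (of_nat (Suc (b j)) * moment (b(i := Suc (b i))))
     = of_nat (p choose b j) * (of_nat (Suc (b i)) * moment (b(j := Suc (b j))))"
    by (rule cancel)
  with \<open>of_nat (p choose b j) \<noteq> 0\<close> show ?thesis
    by (metis mult_left_cancel)
qed simp

text \<open>Multiplying the integrand by sum |z_i|^2, which is 1 almost everywhere, changes
  nothing.\<close>

lemma sum_moment: "(\<Sum>i\<in>UNIV. moment (b(i := Suc (b i)))) = moment b"
proof -
  have "bimonom (b(i := Suc (b i))) (b(i := Suc (b i))) z = bimonom b b z * of_real ((cmod (z $ i))\<^sup>2)" for i z
  proof -
    have "(\<Prod>k\<in>UNIV. (tau2 z $ k) ^ (b(i := Suc (b i))) k) = (\<Prod>k\<in>UNIV. (tau2 z $ k) ^ b k * (if k = i then tau2 z $ k else 1))"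
      by (intro prod.cong) auto
    also have "\<dots> = (\<Prod>k\<in>UNIV. (tau2 z $ k) ^ b k) * tau2 z $ i"
      by (simp add: prod.distrib prod.delta)
    finally show ?thesis by (simp add: bimonom_diag tau2_nth)
  qed
  then have "(\<Sum>i\<in>UNIV. bimonom (b(i := Suc (b i))) (b(i := Suc (b i))) z) = bimonom b b z * of_real ((norm z)\<^sup>2)" for z
    by (simp add: sum_distrib_left[symmetric] sum_tau2[symmetric] tau2_nth)
  then have "AE x in N. bimonom b b (\<zeta> x) = (\<Sum>i\<in>UNIV. bimonom (b(i := Suc (b i))) (b(i := Suc (b i))) (\<zeta> x))"
    using AE_norm by auto
  moreover have "integrable N (\<lambda>x. \<Sum>i\<in>UNIV. bimonom (b(i := Suc (b i))) (b(i := Suc (b i))) (\<zeta> x))"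
    by (intro Bochner_Integration.integrable_sum integrable_bimonom refl)
  ultimately have "moment b = (\<integral>x. (\<Sum>i\<in>UNIV. bimonom (b(i := Suc (b i))) (b(i := Suc (b i))) (\<zeta> x)) \<partial>N)"
    unfolding moment_def
    by (intro integral_cong_AE borel_measurable_integrable integrable_bimonom refl)
  then show ?thesis
    by (subst (asm) Bochner_Integration.integral_sum) (auto simp: moment_def integrable_bimonom)
qed

text \<open>Summing the exchange identity over j gives the moment of b on one side and, on the
  other, the factor sum (b_j + 1) = |b| + n.\<close>

lemma moment_Suc:
  "moment (b(i := Suc (b i))) = of_nat (Suc (b i)) / of_nat (sum b UNIV + CARD('n)) * moment b"
proof -
  have "of_nat (Suc (b i)) * moment b = (\<Sum>j\<in>UNIV. of_nat (Suc (b i)) * moment (b(j := Suc (b j))))"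
    by (simp add: sum_distrib_left[symmetric] sum_moment)
  also have "\<dots> = (\<Sum>j\<in>UNIV. of_nat (Suc (b j)) * moment (b(i := Suc (b i))))"
    by (simp only: moment_exchange)
  also have "\<dots> = of_nat (sum b UNIV + CARD('n)) * moment (b(i := Suc (b i)))"
    by (simp add: sum_distrib_right[symmetric] sum.distrib add.commute)
  finally show ?thesis
    using zero_less_card_finite[where 'a='n]
    by (simp add: field_simps del: of_nat_add of_nat_Suc)
qed

lemma moment_0: "moment (\<lambda>_. 0) = 1"
  by (simp add: moment_def bimonom_def prob_space)

end

text \<open>The recursion is treated abstractly because two instances of the locale, over different
  spaces, have to be compared. Any multi-index is reached from 0 by unit increments.\<close>

lemma moment_unique:
  fixes e e' :: "('n::finite \<Rightarrow> nat) \<Rightarrow> complex"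
  assumes "e (\<lambda>_. 0) = e' (\<lambda>_. 0)"
    and "\<And>b i. e (b(i := Suc (b i))) = r b i * e b"
    and "\<And>b i. e' (b(i := Suc (b i))) = r b i * e' b"
  shows "e b = e' b"
proof (induction "sum b UNIV" arbitrary: b)
  case 0
  then have "b = (\<lambda>_. 0)" by (simp add: fun_eq_iff)
  then show ?case using assms by simp
next
  case (Suc m)
  then obtain i where i: "b i > 0"
    by (metis Zero_not_Suc gr0I sum.neutral)
  define b' where "b' = b(i := b i - 1)"
  have b: "b = b'(i := Suc (b' i))" using i by (auto simp: b'_def)
  have "sum b UNIV = Suc (sum b' UNIV)"
  proof -
    have "sum b UNIV = (\<Sum>k\<in>UNIV. b' k + (if k = i then 1 else 0))"
      by (subst b) (intro sum.cong, auto)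
    then show ?thesis by (simp add: sum.distrib)
  qed
  then have "e b' = e' b'" using Suc by simp
  then show ?case by (subst (1 2) b) (simp add: assms)
qed

section \<open>Quotient measures\<close>

lemma space_quotient_borel [simp]: "space (quotient_borel X q) = q ` X"
  unfolding quotient_borel_def by (rule space_measure_of) auto

lemma sets_quotient_borelI:
  assumes "U \<subseteq> q ` X" "openin (top_of_set X) (X \<inter> q -` U)"
  shows "U \<in> sets (quotient_borel X q)"
  unfolding quotient_borel_def using assms by (subst sets_measure_of) auto

lemma borel_measurable_quotient_borel:
  fixes f :: "'b \<Rightarrow> 'c::topological_space"
  assumes "continuous_on X (\<lambda>x. f (q x))"
  shows "f \<in> borel_measurable (quotient_borel X q)"
proof (rule borel_measurableI)
  fix S :: "'c set" assume "open S"
  have "X \<inter> q -` (f -` S \<inter> q ` X) = X \<inter> (\<lambda>x. f (q x)) -` S" by auto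
  moreover have "openin (top_of_set X) (X \<inter> (\<lambda>x. f (q x)) -` S)"
    using assms \<open>open S\<close> by (rule continuous_openin_preimage_gen)
  ultimately show "f -` S \<inter> space (quotient_borel X q) \<in> sets (quotient_borel X q)"
    by (auto intro!: sets_quotient_borelI)
qed

lemma measurable_quotient_borel_lift:
  assumes h: "continuous_on X h" "h ` X \<subseteq> X" and \<phi>: "\<And>x. x \<in> X \<Longrightarrow> \<phi> (q x) = q (h x)"
  shows "\<phi> \<in> measurable (quotient_borel X q) (quotient_borel X q)"
proof -
  have "\<phi> -` U \<inter> space (quotient_borel X q) \<in> sets (quotient_borel X q)"
    if U: "U \<subseteq> q ` X" "openin (top_of_set X) (X \<inter> q -` U)" for U
  proof -
    have "X \<inter> q -` (\<phi> -` U \<inter> q ` X) = X \<inter> h -` (X \<inter> q -` U)"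
      using h by (auto simp flip: \<phi>)
    moreover have "openin (top_of_set X) (X \<inter> h -` (X \<inter> q -` U))"
      using h U by (intro continuous_openin_preimage[where T=X]) auto
    ultimately show ?thesis by (auto intro!: sets_quotient_borelI)
  qed
  then show ?thesis
    using h(2) \<phi> unfolding quotient_borel_def[of X q]
    by (intro measurable_measure_of) (auto simp: quotient_borel_def[symmetric])
qed

text \<open>One statement serves the circle and the torus (q the identity), the quotient torus
  (\<open>phase_class\<close>) and projective space (\<open>hopf\<close>). The continuous lift
  \<open>h\<close> supplies the measurability of \<open>\<phi>\<close> that the transformation
  formula requires.\<close>

lemma invariant_prob_integral:
  fixes f :: "'b \<Rightarrow> 'c::{banach, second_countable_topology}"
  assumes M: "invariant_prob (quotient_borel X q) \<Phi> M" "\<phi> \<in> \<Phi>"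
    and h: "continuous_on X h" "h ` X \<subseteq> X" and \<phi>: "\<And>x. x \<in> X \<Longrightarrow> \<phi> (q x) = q (h x)"
    and f: "continuous_on X (\<lambda>x. f (q x))"
  shows "(\<integral>x. f (\<phi> x) \<partial>M) = (\<integral>x. f x \<partial>M)"
proof -
  have s: "sets M = sets (quotient_borel X q)" and inv: "distr M M \<phi> = M"
    using M by (auto simp: invariant_prob_def)
  have "\<phi> \<in> measurable M M"
    using measurable_quotient_borel_lift[of X h \<phi> q, OF h \<phi>] by (simp add: measurable_cong_sets[OF s s])
  moreover have "f \<in> borel_measurable M"
    using borel_measurable_quotient_borel[of X f q, OF f] by (simp add: measurable_cong_sets[OF s refl])
  ultimately have "(\<integral>x. f x \<partial>distr M M \<phi>) = (\<integral>x. f (\<phi> x) \<partial>M)"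
    by (rule integral_distr)
  then show ?thesis by (simp add: inv)
qed

lemma invariant_prob_space:
  assumes "invariant_prob (quotient_borel X q) \<Phi> M"
  shows "space M = q ` X" "prob_space M"
  using assms sets_eq_imp_space_eq[of M "quotient_borel X q"] by (auto simp: invariant_prob_def)

section \<open>Orthogonality of characters on the three tori\<close>

lemma haar_circle_integral:
  assumes "haar_circle \<nu>"
  shows "(\<integral>z. z powi k \<partial>\<nu>) = (if k = 0 then 1 else 0)"
proof (cases "k = 0")
  case True
  then show ?thesis
    using assms prob_space.prob_space[of \<nu>]
    by (auto simp: haar_circle_def dest!: invariant_prob_space(2))
next
  case False
  obtain c where c: "cmod c = 1" "c powi k = -1"
    using ex_unit_powi_eq_minus_1[OF False] by auto
  have "(\<integral>z. (c * z) powi k \<partial>\<nu>) = (\<integral>z. z powi k \<partial>\<nu>)"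
  proof (rule invariant_prob_integral[OF assms[unfolded haar_circle_def], where h="\<lambda>z. c * z"])
    show "continuous_on (sphere 0 1) (\<lambda>z::complex. id z powi k)"
      by (auto intro!: continuous_intros)
  qed (use c in \<open>auto intro!: continuous_intros simp: norm_mult\<close>)
  then show ?thesis using c False by (simp add: power_int_mult_distrib)
qed

lemma torus_mult: "g \<in> torus_set \<Longrightarrow> z \<in> torus_set \<Longrightarrow> g * z \<in> torus_set"
  by (simp add: torus_set_def norm_mult)

lemma continuous_on_vec_mult_left: "continuous_on A (\<lambda>z::complex ^ 'n. g * z)"
  unfolding times_vec_def by (intro continuous_intros)

lemma bimonom_diag_torus: "g \<in> torus_set \<Longrightarrow> bimonom a a g = 1"
  by (simp add: bimonom_torus)

lemma haar_torus_integral: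
  assumes "haar_torus \<nu>"
  shows "(\<integral>z. bimonom a b z \<partial>\<nu>) = (if a = b then 1 else 0)"
proof (cases "a = b")
  case True
  have "(\<integral>z. bimonom a b z \<partial>\<nu>) = (\<integral>z. 1 \<partial>\<nu>)"
    using invariant_prob_space(1)[OF assms[unfolded haar_torus_def]] True
    by (intro Bochner_Integration.integral_cong) (auto simp: bimonom_diag_torus)
  then show ?thesis
    using prob_space.prob_space[OF invariant_prob_space(2)[OF assms[unfolded haar_torus_def]]] True by simp
next
  case False
  obtain g where g: "g \<in> torus_set" "bimonom a b g = -1"
    using ex_torus_bimonom_eq_minus_1[OF False] by auto
  have "(\<integral>z. bimonom a b (g * z) \<partial>\<nu>) = (\<integral>z. bimonom a b z \<partial>\<nu>)"
    using g by (intro invariant_prob_integral[OF assms[unfolded haar_torus_def], where h="\<lambda>z. g * z"])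
      (auto intro!: continuous_intros continuous_on_vec_mult_left torus_mult)
  then show ?thesis using g False by (simp add: bimonom_mult)
qed

lemma class_rep_phase_class: "\<exists>c. cmod c = 1 \<and> class_rep (phase_class z) = c *s z"
proof -
  have "1 *s z \<in> phase_class z" unfolding phase_class_def by (metis (mono_tags, lifting) mem_Collect_eq norm_one)
  then have "class_rep (phase_class z) \<in> phase_class z"
    unfolding class_rep_def by (rule someI)
  then show ?thesis by (auto simp: phase_class_def)
qed

lemma scale_mult_scale: "(c *s g) * (d *s z) = (c * d) *s (g * (z :: complex ^ 'n))"
  by (simp add: vec_eq_iff ac_simps)

lemma class_mult_phase_class: "class_mult (phase_class g) (phase_class z) = phase_class (g * z)"
proof (intro equalityI subsetI)
  fix w assume "w \<in> class_mult (phase_class g) (phase_class z)"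
  then obtain c d where "cmod c = 1" "cmod d = 1" "w = (c *s g) * (d *s z)"
    by (auto simp: class_mult_def phase_class_def)
  then show "w \<in> phase_class (g * z)"
    unfolding phase_class_def by (auto simp: scale_mult_scale norm_mult intro!: exI[of _ "c * d"])
next
  fix w assume "w \<in> phase_class (g * z)"
  then obtain c where c: "cmod c = 1" "w = (c *s g) * (1 *s z)"
    by (auto simp: phase_class_def vec_eq_iff)
  moreover have "c *s g \<in> phase_class g" "1 *s z \<in> phase_class z"
    using c(1) norm_one unfolding phase_class_def by blast+
  ultimately show "w \<in> class_mult (phase_class g) (phase_class z)"
    unfolding class_mult_def by blast
qed

lemma bimonom_class_rep:
  assumes "sum a UNIV = sum b UNIV"
  shows "bimonom a b (class_rep (phase_class z)) = bimonom a b z"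
  using class_rep_phase_class[of z] bimonom_phase[OF assms] by auto

lemma haar_psu_torus_integral:
  assumes "haar_psu_torus \<nu>" and deg: "sum a UNIV = sum b UNIV"
  shows "(\<integral>G. bimonom a b (class_rep G) \<partial>\<nu>) = (if a = b then 1 else 0)"
proof (cases "a = b")
  case True
  note sp = invariant_prob_space[OF assms(1)[unfolded haar_psu_torus_def]]
  have "(\<integral>G. bimonom a b (class_rep G) \<partial>\<nu>) = (\<integral>G. 1 \<partial>\<nu>)"
    using sp(1) True
    by (intro Bochner_Integration.integral_cong) (auto simp: bimonom_class_rep bimonom_diag_torus)
  then show ?thesis using prob_space.prob_space[OF sp(2)] True by simp
next
  case False
  note sp = invariant_prob_space[OF assms(1)[unfolded haar_psu_torus_def]]
  obtain g where g: "g \<in> torus_set" "bimonom a b g = -1"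
    using ex_torus_bimonom_eq_minus_1[OF False] by auto
  have "(\<integral>G. bimonom a b (class_rep (class_mult (phase_class g) G)) \<partial>\<nu>) = (\<integral>G. bimonom a b (class_rep G) \<partial>\<nu>)"
    using g
    by (intro invariant_prob_integral[OF assms(1)[unfolded haar_psu_torus_def], where h="\<lambda>z. g * z"
          and f="\<lambda>G. bimonom a b (class_rep G)"])
      (auto intro!: continuous_intros continuous_on_vec_mult_left torus_mult class_mult_phase_class
        simp: bimonom_class_rep[OF deg])
  moreover have "(\<integral>G. bimonom a b (class_rep (class_mult (phase_class g) G)) \<partial>\<nu>) = (\<integral>G. - bimonom a b (class_rep G) \<partial>\<nu>)"
    using sp(1) g
    by (intro Bochner_Integration.integral_cong)
       (auto simp: class_mult_phase_class bimonom_class_rep[OF deg] bimonom_mult)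
  ultimately show ?thesis using False by simp
qed

section \<open>Unitary invariance on the sphere and on projective space\<close>

lemma linear_matrix_vector_mult: "linear (\<lambda>z. (U :: complex ^ 'n ^ 'n) *v z)"
  by (intro linearI)
     (simp_all add: matrix_vector_right_distrib vec_eq_iff matrix_vector_mult_def scaleR_sum_right
       distrib_left sum.distrib)

lemma of_real_norm_vec_square: "complex_of_real ((norm z)\<^sup>2) = (\<Sum>i\<in>UNIV. z $ i * cnj (z $ i))"
  unfolding sum_tau2[symmetric] by (simp only: of_real_sum tau2_nth complex_norm_square)

lemma norm_unitary_mult:
  assumes "unitary_matrix U"
  shows "norm (U *v z) = norm z"
proof -
  have U: "(\<Sum>i\<in>UNIV. cnj (U $ i $ l) * U $ i $ k) = (if l = k then 1 else 0)" for k l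
    using assms by (simp add: unitary_matrix_def matrix_matrix_mult_def mat_def vec_eq_iff)
  have "(\<Sum>i\<in>UNIV. (U *v z) $ i * cnj ((U *v z) $ i))
      = (\<Sum>i\<in>UNIV. \<Sum>k\<in>UNIV. \<Sum>l\<in>UNIV. z $ k * cnj (z $ l) * (cnj (U $ i $ l) * U $ i $ k))"
    by (simp add: matrix_vector_mult_def sum_product ac_simps)
  also have "\<dots> = (\<Sum>k\<in>UNIV. \<Sum>l\<in>UNIV. \<Sum>i\<in>UNIV. z $ k * cnj (z $ l) * (cnj (U $ i $ l) * U $ i $ k))"
    by (subst (1) sum.swap) (intro sum.cong refl sum.swap)
  also have "\<dots> = (\<Sum>k\<in>UNIV. z $ k * cnj (z $ k))"
    by (simp add: sum_distrib_left[symmetric] U if_distrib[of "\<lambda>x. _ * x"] sum.delta cong: if_cong)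
  finally have "complex_of_real ((norm (U *v z))\<^sup>2) = complex_of_real ((norm z)\<^sup>2)"
    by (simp only: of_real_norm_vec_square)
  then show ?thesis
    unfolding of_real_eq_iff by simp
qed

lemma sphere_measure_integral_linear_isometry:
  fixes f :: "complex ^ 'n \<Rightarrow> complex" and T :: "complex ^ 'n \<Rightarrow> complex ^ 'n"
  assumes "linear T" "\<And>x. norm (T x) = norm x" "continuous_on UNIV f"
  shows "(\<integral>z. f (T z) \<partial>sphere_measure) = (\<integral>z. f z \<partial>sphere_measure)"
proof -
  have "T \<in> borel_measurable borel" "f \<in> borel_measurable borel"
    using assms by (simp_all add: linear_continuous_on linear_linear borel_measurable_continuous_onI)
  then show ?thesis
    by (subst (2) sphere_measure_distr_linear_isometry[of T, OF assms(1,2), symmetric])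
       (simp add: integral_distr)
qed

interpretation sphere: unitary_moments sphere_measure "\<lambda>z. z"
proof (intro unitary_moments.intro unitary_moments_axioms.intro)
  show "prob_space sphere_measure" by (rule prob_space_sphere_measure)
  show "AE z in sphere_measure. norm z = 1" by (rule AE_sphere_measure_norm)
  fix f :: "complex ^ 'a \<Rightarrow> complex" assume f: "phase_invariant f"
  then have c: "continuous_on UNIV f" by (simp add: phase_invariant_def)
  then show "f \<in> borel_measurable sphere_measure"
    by (simp add: measurable_cong_sets[OF sets_sphere_measure refl] borel_measurable_continuous_onI)
  fix U :: "complex ^ 'a ^ 'a" assume "unitary_matrix U"
  with c show "(\<integral>z. f (U *v z) \<partial>sphere_measure) = (\<integral>z. f z \<partial>sphere_measure)"
    by (intro sphere_measure_integral_linear_isometry linear_matrix_vector_mult norm_unitary_mult)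
qed

lemma norm_vec_scale: "norm (c *s (z :: complex ^ 'n)) = cmod c * norm z"
  by (simp add: norm_vec_def norm_mult L2_set_right_distrib)

lemma integrable_sphere_continuous:
  fixes f :: "complex ^ 'n \<Rightarrow> complex"
  assumes "continuous_on UNIV f"
  shows "integrable sphere_measure f"
proof -
  obtain B where B: "\<And>z. norm z = 1 \<Longrightarrow> norm (f z) \<le> B"
    using ex_bound_on_sphere[OF assms] by auto
  show ?thesis
    using sphere.AE_norm B assms
    by (intro sphere.integrable_const_bound[where B=B])
       (auto simp: measurable_cong_sets[OF sets_sphere_measure refl] borel_measurable_continuous_onI)
qed

lemma linear_vec_scale: "linear (\<lambda>z. c *s (z :: complex ^ 'n))"
  by (intro linearI) (simp_all add: vec_eq_iff algebra_simps)

text \<open>Unbalanced monomials are not phase invariant and lie outside the locale. They vanish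
  already under scalar phases, which act on the sphere as isometries.\<close>

lemma integral_sphere_bimonom_unbalanced:
  assumes "sum a UNIV \<noteq> sum b UNIV"
  shows "(\<integral>z. bimonom a b z \<partial>sphere_measure) = 0"
proof -
  obtain c where c: "cmod c = 1" "c powi (int (sum a UNIV) - int (sum b UNIV)) = -1"
    using ex_unit_powi_eq_minus_1[of "int (sum a UNIV) - int (sum b UNIV)"] assms by (metis eq_iff_diff_eq_0 of_nat_eq_iff)
  have "(\<integral>z. bimonom a b (c *s z) \<partial>sphere_measure) = (\<integral>z. bimonom a b z \<partial>sphere_measure)"
    using c by (intro sphere_measure_integral_linear_isometry linear_vec_scale continuous_intros)
      (simp add: norm_vec_scale)
  then show ?thesis
    using c by (simp add: bimonom_scale unit_power_mult_cnj_power)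
qed

lemma unit_rep_hopf:
  assumes "norm z = 1"
  shows "\<exists>c. cmod c = 1 \<and> unit_rep (hopf z) = c *s z"
proof -
  have "1 *s z \<in> hopf z" unfolding hopf_def by blast
  then have "z \<in> hopf z \<and> norm z = 1" using assms by simp
  then have "unit_rep (hopf z) \<in> hopf z \<and> norm (unit_rep (hopf z)) = 1"
    unfolding unit_rep_def by (rule someI)
  then show ?thesis using assms by (auto simp: hopf_def norm_vec_scale)
qed

lemma phase_invariant_unit_rep:
  assumes "phase_invariant f" "norm z = 1"
  shows "f (unit_rep (hopf z)) = f z"
  using unit_rep_hopf[OF assms(2)] assms(1) by (auto simp: phase_invariant_def)

lemma matrix_image_hopf: "(\<lambda>z. U *v z) ` hopf z = hopf (U *v (z :: complex ^ 'n))"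
proof -
  have "U *v (c *s z) = c *s (U *v z)" for c
    by (simp add: matrix_vector_mult_def vec_eq_iff sum_distrib_left ac_simps)
  then show ?thesis by (simp add: hopf_def full_SetCompr_eq image_image)
qed

lemma unitary_moments_cp:
  assumes "unitarily_invariant \<mu>"
  shows "unitary_moments \<mu> unit_rep"
proof -
  note inv = assms[unfolded unitarily_invariant_def]
  note sp = invariant_prob_space[OF inv]
  show ?thesis
  proof (intro unitary_moments.intro unitary_moments_axioms.intro)
    show "prob_space \<mu>" by (rule sp)
    show "AE x in \<mu>. norm (unit_rep x) = 1"
    proof (rule AE_I2)
      fix L assume "L \<in> space \<mu>"
      then obtain z where "norm z = 1" "L = hopf z" using sp by auto
      then show "norm (unit_rep L) = 1"
        using unit_rep_hopf[of z] by (auto simp: norm_vec_scale)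
    qed
    fix f :: "complex ^ 'a \<Rightarrow> complex" assume f: "phase_invariant f"
    have "continuous_on (sphere 0 1) f"
      using f by (auto simp: phase_invariant_def intro: continuous_on_subset)
    then have c: "continuous_on (sphere 0 1) (\<lambda>z. f (unit_rep (hopf z)))"
      by (rule continuous_on_eq) (simp add: phase_invariant_unit_rep[OF f])
    then show "(\<lambda>x. f (unit_rep x)) \<in> borel_measurable \<mu>"
      using borel_measurable_quotient_borel[of _ "\<lambda>L. f (unit_rep L)" hopf, OF c] inv
      by (simp add: invariant_prob_def measurable_cong_sets[of \<mu> "quotient_borel (sphere 0 1) hopf" borel borel])
    fix U :: "complex ^ 'a ^ 'a" assume U: "unitary_matrix U"
    have "(\<integral>L. f (unit_rep ((\<lambda>z. U *v z) ` L)) \<partial>\<mu>) = (\<integral>L. f (unit_rep L) \<partial>\<mu>)"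
      using U c
      by (intro invariant_prob_integral[OF inv, where h="\<lambda>z. U *v z" and f="\<lambda>L. f (unit_rep L)"])
         (auto simp: norm_unitary_mult matrix_image_hopf
           intro!: linear_continuous_on linear_linear[THEN iffD1] linear_matrix_vector_mult)
    \<comment> \<open>The representative of the image line and the image of the representative are
      unit vectors on one line; they may differ by a phase, which f does not see.\<close>
    moreover have "f (unit_rep ((\<lambda>z. U *v z) ` L)) = f (U *v unit_rep L)" if L: "L \<in> space \<mu>" for L
    proof -
      obtain z where z: "norm z = 1" "L = hopf z" using sp L by auto
      obtain d where d: "cmod d = 1" "unit_rep L = d *s z" using unit_rep_hopf z by blast
      have "U *v unit_rep L = d *s (U *v z)"
        by (simp add: d matrix_vector_mult_def vec_eq_iff sum_distrib_left ac_simps)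
      then have "f (U *v unit_rep L) = f (U *v z)"
        using d(1) f by (simp add: phase_invariant_def)
      then show ?thesis
        using phase_invariant_unit_rep[OF f, of "U *v z"] z U
        by (simp add: matrix_image_hopf norm_unitary_mult)
    qed
    ultimately show "(\<integral>x. f (U *v unit_rep x) \<partial>\<mu>) = (\<integral>x. f (unit_rep x) \<partial>\<mu>)"
      by (simp cong: Bochner_Integration.integral_cong)
  qed
qed

text \<open>Off the diagonal both integrals are 0; on it both satisfy the same recursion with the
  same initial value. This transfers integrals between the sphere and projective space.\<close>

lemma unitary_moments_eq:
  fixes \<zeta> :: "'b \<Rightarrow> complex ^ 'n" and \<zeta>' :: "'c \<Rightarrow> complex ^ 'n"
  assumes "unitary_moments N \<zeta>" "unitary_moments N' \<zeta>'" and deg: "sum a UNIV = sum b UNIV"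
  shows "(\<integral>x. bimonom a b (\<zeta> x) \<partial>N) = (\<integral>x. bimonom a b (\<zeta>' x) \<partial>N')"
proof (cases "a = b")
  case True
  have "unitary_moments.moment N \<zeta> b = unitary_moments.moment N' \<zeta>' b"
  proof (rule moment_unique)
    show "unitary_moments.moment N \<zeta> (\<lambda>_. 0) = unitary_moments.moment N' \<zeta>' (\<lambda>_. 0)"
      using assms(1,2) by (simp add: unitary_moments.moment_0)
  qed (rule unitary_moments.moment_Suc[OF assms(1)] unitary_moments.moment_Suc[OF assms(2)])+
  then show ?thesis
    using assms(1,2) True by (simp add: unitary_moments.moment_def)
next
  case False
  then show ?thesis
    using assms by (simp add: unitary_moments.integral_bimonom_off_diag)
qed

lemma integral_simplex_measure:
  "of_real (\<integral>y. (\<Prod>i\<in>UNIV. (y $ i) ^ b i) \<partial>simplex_measure) = (\<integral>z. bimonom b b z \<partial>sphere_measure)"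
proof -
  have "(\<integral>y. (\<Prod>i\<in>UNIV. (y $ i) ^ b i) \<partial>simplex_measure)
     = (\<integral>z. (\<Prod>i\<in>UNIV. (tau2 z $ i) ^ b i) \<partial>sphere_measure)"
    by (subst distr_sphere_measure_tau2[symmetric], subst integral_distr) auto
  then show ?thesis
    by (simp only: bimonom_diag integral_complex_of_real)
qed

section \<open>Spanning sets of polynomials\<close>

text \<open>The scale case concerns multiples of generators only, so exactness need be checked just
  on monomials.\<close>

lemma lin_span_induct [consumes 1, case_names zero add scale]:
  assumes "P \<in> lin_span B" "Q (\<lambda>_. 0)" "\<And>f g. Q f \<Longrightarrow> Q g \<Longrightarrow> Q (\<lambda>x. f x + g x)"
    "\<And>c f. f \<in> B \<Longrightarrow> Q (\<lambda>x. c * f x)"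
  shows "Q P"
proof -
  obtain S c where S: "finite S" "S \<subseteq> B" and P: "P = (\<lambda>x. \<Sum>f\<in>S. c f * f x)"
    using assms(1) by (auto simp: lin_span_def)
  from S show ?thesis
    unfolding P by (induction S) (auto intro: assms)
qed

lemma lin_spanI: "finite S \<Longrightarrow> S \<subseteq> B \<Longrightarrow> (\<lambda>x. \<Sum>f\<in>S. c f * f x) \<in> lin_span B"
  unfolding lin_span_def by blast

lemma lin_span_base:
  assumes "f \<in> B"
  shows "f \<in> lin_span B"
  using lin_spanI[of "{f}" B "\<lambda>_. 1"] assms by simp

lemma lin_span_zero: "(\<lambda>_. 0) \<in> lin_span B"
  using lin_spanI[of "{}" B] by simp

lemma lin_span_add:
  assumes "F \<in> lin_span B" "G \<in> lin_span B"
  shows "(\<lambda>x. F x + G x) \<in> lin_span B"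
proof -
  obtain S c where S: "finite S" "S \<subseteq> B" and F: "F = (\<lambda>x. \<Sum>f\<in>S. c f * f x)"
    using assms(1) by (auto simp: lin_span_def)
  obtain S' c' where S': "finite S'" "S' \<subseteq> B" and G: "G = (\<lambda>x. \<Sum>f\<in>S'. c' f * f x)"
    using assms(2) by (auto simp: lin_span_def)
  define d where "d f = (if f \<in> S then c f else 0) + (if f \<in> S' then c' f else 0)" for f
  have "F x = (\<Sum>f\<in>S \<union> S'. (if f \<in> S then c f else 0) * f x)" for x
    unfolding F using S S' by (intro sum.mono_neutral_cong_left) auto
  moreover have "G x = (\<Sum>f\<in>S \<union> S'. (if f \<in> S' then c' f else 0) * f x)" for x
    unfolding G using S S' by (intro sum.mono_neutral_cong_left) auto
  ultimately have "(\<lambda>x. F x + G x) = (\<lambda>x. \<Sum>f\<in>S \<union> S'. d f * f x)"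
    by (simp add: d_def sum.distrib distrib_right)
  then show ?thesis
    using S S' lin_spanI[of "S \<union> S'" B d] by simp
qed

lemma lin_span_cmult:
  assumes "F \<in> lin_span B"
  shows "(\<lambda>x. k * F x) \<in> lin_span B"
proof -
  obtain S c where S: "finite S" "S \<subseteq> B" and F: "F = (\<lambda>x. \<Sum>f\<in>S. c f * f x)"
    using assms(1) by (auto simp: lin_span_def)
  have "(\<lambda>x. k * F x) = (\<lambda>x. \<Sum>f\<in>S. (k * c f) * f x)"
    by (simp add: F sum_distrib_left mult.assoc)
  then show ?thesis
    using S lin_spanI[of S B "\<lambda>f. k * c f"] by simp
qed

lemma lin_span_mono: "B \<subseteq> B' \<Longrightarrow> lin_span B \<subseteq> lin_span B'"
  unfolding lin_span_def by blast

lemma prod_mset_in_poly_deg_le: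
  assumes "set_mset m \<subseteq> C" "size m \<le> d"
  shows "(\<lambda>x. \<Prod>f\<in>#m. f x) \<in> poly_deg_le C d"
  unfolding poly_deg_le_def using assms by (intro lin_span_base) blast

section \<open>Real polynomials as complex combinations of torus eigenfunctions\<close>

definition bimonoms :: "nat \<Rightarrow> (complex ^ 'n \<Rightarrow> complex) set" where
  "bimonoms d = {bimonom a b | a b. sum a UNIV + sum b UNIV \<le> d}"

lemma bimonomsI: "sum a UNIV + sum b UNIV \<le> d \<Longrightarrow> bimonom a b \<in> bimonoms d"
  unfolding bimonoms_def by blast

lemma prod_power_upd_Suc:
  fixes f :: "'n::finite \<Rightarrow> 'a::comm_monoid_mult"
  shows "(\<Prod>i\<in>UNIV. f i ^ (a(k := Suc (a k))) i) = f k * (\<Prod>i\<in>UNIV. f i ^ a i)"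
proof -
  have "(\<Prod>i\<in>UNIV. f i ^ (a(k := Suc (a k))) i) = (\<Prod>i\<in>UNIV. (if i = k then f i else 1) * f i ^ a i)"
    by (intro prod.cong) auto
  then show ?thesis by (simp add: prod.distrib)
qed

lemma sum_upd_Suc: "sum (a(k := Suc (a k))) UNIV = Suc (sum (a :: 'n::finite \<Rightarrow> nat) UNIV)"
proof -
  have "sum (a(k := Suc (a k))) UNIV = (\<Sum>i\<in>UNIV. (if i = k then 1 else 0) + a i)"
    by (intro sum.cong) auto
  then show ?thesis by (simp add: sum.distrib)
qed

lemma nth_mult_bimonom: "z $ k * bimonom a b z = bimonom (a(k := Suc (a k))) b z"
  by (simp only: bimonom_def prod.distrib prod_power_upd_Suc mult.assoc)

lemma cnj_nth_mult_bimonom: "cnj (z $ k) * bimonom a b z = bimonom a (b(k := Suc (b k))) z"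
  by (simp only: bimonom_def prod.distrib prod_power_upd_Suc[where f="\<lambda>i. cnj (z $ i)"] mult.left_commute)

lemma lin_span_bimonoms_nth_mult:
  assumes "F \<in> lin_span (bimonoms d)"
  shows "(\<lambda>z. z $ k * F z) \<in> lin_span (bimonoms (Suc d))"
    and "(\<lambda>z. cnj (z $ k) * F z) \<in> lin_span (bimonoms (Suc d))"
proof -
  have "(\<lambda>z. z $ k * F z) \<in> lin_span (bimonoms (Suc d)) \<and> (\<lambda>z. cnj (z $ k) * F z) \<in> lin_span (bimonoms (Suc d))"
    using assms
  proof (induct rule: lin_span_induct)
    case (scale c f)
    then obtain a b where f: "f = bimonom a b" and deg: "sum a UNIV + sum b UNIV \<le> d"
      by (auto simp: bimonoms_def)
    have mem: "bimonom (a(k := Suc (a k))) b \<in> bimonoms (Suc d)" "bimonom a (b(k := Suc (b k))) \<in> bimonoms (Suc d)"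
      using deg by (auto intro!: bimonomsI simp: sum_upd_Suc simp del: fun_upd_apply)
    have "(\<lambda>z. c * bimonom (a(k := Suc (a k))) b z) \<in> lin_span (bimonoms (Suc d))"
      "(\<lambda>z. c * bimonom a (b(k := Suc (b k))) z) \<in> lin_span (bimonoms (Suc d))"
      by (rule lin_span_cmult[OF lin_span_base[OF mem(1)]] lin_span_cmult[OF lin_span_base[OF mem(2)]])+
    then show ?case
      by (simp add: f mult.left_commute[of _ c] nth_mult_bimonom cnj_nth_mult_bimonom)
  qed (auto simp: distrib_left intro: lin_span_zero lin_span_add)
  then show "(\<lambda>z. z $ k * F z) \<in> lin_span (bimonoms (Suc d))"
    and "(\<lambda>z. cnj (z $ k) * F z) \<in> lin_span (bimonoms (Suc d))" by auto
qed

text \<open>Each real coordinate is a combination of z_k and its conjugate, so every factor raises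
  the total degree by one at most. The passage to complex coefficients is needed because real
  coordinates are not torus eigenfunctions.\<close>

lemma real_prod_in_lin_span_bimonoms:
  fixes m :: "(complex ^ 'n \<Rightarrow> real) multiset"
  assumes "set_mset m \<subseteq> {(\<lambda>z. Re (z $ k)) | k. True} \<union> {(\<lambda>z. Im (z $ k)) | k. True}"
  shows "(\<lambda>z. complex_of_real (\<Prod>f\<in>#m. f z)) \<in> lin_span (bimonoms (size m))"
  using assms
proof (induction m)
  case empty
  have "(\<lambda>z::complex^'n. 1) = bimonom (\<lambda>_. 0) (\<lambda>_. 0)" by (simp add: bimonom_def fun_eq_iff)
  moreover have "bimonom (\<lambda>_. 0) (\<lambda>_. 0) \<in> (bimonoms 0 :: (complex ^ 'n \<Rightarrow> complex) set)" by (rule bimonomsI) simp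
  ultimately show ?case by (simp add: lin_span_base)
next
  case (add f m)
  let ?F = "\<lambda>z. complex_of_real (\<Prod>f\<in>#m. f z)"
  have F: "?F \<in> lin_span (bimonoms (size m))" using add by simp
  from add.prems obtain k where "f = (\<lambda>z. Re (z $ k)) \<or> f = (\<lambda>z. Im (z $ k))" by auto
  then have "\<exists>u v. \<forall>z. complex_of_real (f z) = u * (z $ k) + v * cnj (z $ k)"
  proof
    assume "f = (\<lambda>z. Re (z $ k))"
    then have "complex_of_real (f z) = (1/2) * (z $ k) + (1/2) * cnj (z $ k)" for z
      by (simp add: complex_eq_iff)
    then show ?thesis by blast
  next
    assume "f = (\<lambda>z. Im (z $ k))"
    then have "complex_of_real (f z) = (- \<i>/2) * (z $ k) + (\<i>/2) * cnj (z $ k)" for z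
      by (simp add: complex_eq_iff)
    then show ?thesis by blast
  qed
  then obtain u v where uv: "\<And>z. complex_of_real (f z) = u * (z $ k) + v * cnj (z $ k)" by blast
  have "(\<lambda>z. u * (z $ k * ?F z) + v * (cnj (z $ k) * ?F z)) \<in> lin_span (bimonoms (Suc (size m)))"
    by (intro lin_span_add lin_span_cmult lin_span_bimonoms_nth_mult F)
  then show ?case
    by (simp add: uv distrib_right mult.assoc)
qed

lemma real_poly_in_lin_span_bimonoms:
  fixes P :: "complex ^ 'n \<Rightarrow> real"
  assumes "P \<in> polys sphere_space d"
  shows "(\<lambda>z. complex_of_real (P z)) \<in> lin_span (bimonoms d)"
proof -
  let ?C = "{(\<lambda>z::complex^'n. Re (z $ k)) | k. True} \<union> {(\<lambda>z. Im (z $ k)) | k. True}"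
  have "P \<in> lin_span {(\<lambda>x. \<Prod>f\<in>#m. f x) | m. set_mset m \<subseteq> ?C \<and> size m \<le> d}"
    using assms by (simp add: sphere_space_def poly_deg_le_def)
  then show ?thesis
  proof (induct rule: lin_span_induct)
    case (scale c f)
    then obtain m where f: "f = (\<lambda>x. \<Prod>f\<in>#m. f x)" and m: "set_mset m \<subseteq> ?C" "size m \<le> d"
      by auto
    have "bimonoms (size m) \<subseteq> bimonoms d"
      using m(2) by (auto simp: bimonoms_def intro: le_trans)
    then have "(\<lambda>z. complex_of_real (f z)) \<in> lin_span (bimonoms d)"
      using real_prod_in_lin_span_bimonoms[OF m(1)] lin_span_mono unfolding f by blast
    then show ?case by (simp add: lin_span_cmult)
  qed (auto intro: lin_span_zero lin_span_add)
qed

lemma sphere_exactI: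
  fixes F :: "(complex ^ 'n) formula"
  assumes base: "\<And>a b. sum a UNIV + sum b UNIV \<le> d \<Longrightarrow>
      (\<integral>z. bimonom a b z \<partial>sphere_measure) = (\<Sum>x\<in>nodes F. weight F x *\<^sub>R bimonom a b x)"
    and P: "P \<in> polys sphere_space d"
  shows "(\<integral>z. P z \<partial>sphere_measure) = (\<Sum>x\<in>nodes F. weight F x *\<^sub>R P x)"
proof -
  \<comment> \<open>Integrability is carried through the induction because additivity of the
    integral depends on it.\<close>
  have "integrable sphere_measure (\<lambda>z. complex_of_real (P z)) \<and>
      (\<integral>z. complex_of_real (P z) \<partial>sphere_measure) = (\<Sum>x\<in>nodes F. weight F x *\<^sub>R complex_of_real (P x))"
    using real_poly_in_lin_span_bimonoms[OF P]
  proof (induct rule: lin_span_induct)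
    case (scale c f)
    then obtain a b where f: "f = bimonom a b" and deg: "sum a UNIV + sum b UNIV \<le> d"
      by (auto simp: bimonoms_def)
    have "integrable sphere_measure (bimonom a b)"
      by (intro integrable_sphere_continuous continuous_intros)
    then show ?case
      by (simp add: f base[OF deg] sum_distrib_left)
  qed (auto simp: scaleR_add_right sum.distrib)
  then have "complex_of_real (\<integral>z. P z \<partial>sphere_measure) = complex_of_real (\<Sum>x\<in>nodes F. weight F x *\<^sub>R P x)"
    by (simp add: scaleR_conv_of_real)
  then show ?thesis by (simp only: of_real_eq_iff)
qed

text \<open>Equal numbers of factors z_k and conjugates can be paired off, and a pair counts as
  degree one. The map r stands for \<open>unit_rep\<close> as well as
  \<open>class_rep\<close>.\<close>

lemma ex_mset_bimonom:
  fixes r :: "'x \<Rightarrow> complex ^ 'n"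
  assumes "sum a UNIV = d" "sum b UNIV = d"
  shows "\<exists>m. set_mset m \<subseteq> {(\<lambda>x. r x $ k * cnj (r x $ j)) | k j. True} \<and> size m = d \<and>
     (\<lambda>x. \<Prod>f\<in>#m. f x) = (\<lambda>x. bimonom a b (r x))"
  using assms
proof (induction d arbitrary: a b)
  case 0
  then show ?case by (intro exI[of _ "{#}"]) (simp add: bimonom_def)
next
  case (Suc d)
  obtain k j where kj: "a k > 0" "b j > 0"
    using Suc.prems by (metis Zero_not_Suc gr0I sum.neutral)
  define a' where "a' = a(k := a k - 1)"
  define b' where "b' = b(j := b j - 1)"
  have a: "a = a'(k := Suc (a' k))" and b: "b = b'(j := Suc (b' j))"
    using kj by (auto simp: a'_def b'_def)
  have "sum a' UNIV = d" "sum b' UNIV = d"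
    using Suc.prems sum_upd_Suc[of a' k] sum_upd_Suc[of b' j] a b by auto
  then obtain m where m: "set_mset m \<subseteq> {(\<lambda>x. r x $ k * cnj (r x $ j)) | k j. True}" "size m = d"
     "(\<lambda>x. \<Prod>f\<in>#m. f x) = (\<lambda>x. bimonom a' b' (r x))"
    using Suc.IH by blast
  have "bimonom a b z = z $ k * cnj (z $ j) * bimonom a' b' z" for z
    by (subst a, subst b) (simp only: nth_mult_bimonom[symmetric] cnj_nth_mult_bimonom[symmetric] mult.assoc mult.left_commute)
  then show ?case
    using m by (intro exI[of _ "add_mset (\<lambda>x. r x $ k * cnj (r x $ j)) m"]) (auto simp: fun_eq_iff)
qed

lemma bimonom_in_poly_deg_le:
  fixes r :: "'x \<Rightarrow> complex ^ 'n"
  assumes "sum a UNIV = sum b UNIV" "sum b UNIV \<le> d"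
  shows "(\<lambda>x. bimonom a b (r x)) \<in> poly_deg_le {(\<lambda>x. r x $ k * cnj (r x $ j)) | k j. True} d"
proof -
  obtain m where m: "set_mset m \<subseteq> {(\<lambda>x. r x $ k * cnj (r x $ j)) | k j. True}" "size m = sum b UNIV"
     "(\<lambda>x. \<Prod>f\<in>#m. f x) = (\<lambda>x. bimonom a b (r x))"
    using ex_mset_bimonom[OF assms(1) refl] by blast
  show ?thesis
    unfolding m(3)[symmetric] using m assms by (intro prod_mset_in_poly_deg_le) auto
qed

lemma prod_mset_eq_bimonom:
  fixes r :: "'x \<Rightarrow> complex ^ 'n"
  assumes "set_mset m \<subseteq> {(\<lambda>x. r x $ k * cnj (r x $ j)) | k j. True}"
  shows "\<exists>a b. sum a UNIV = size m \<and> sum b UNIV = size m \<and> (\<lambda>x. \<Prod>f\<in>#m. f x) = (\<lambda>x. bimonom a b (r x))"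
  using assms
proof (induction m)
  case empty
  then show ?case by (intro exI[of _ "\<lambda>_. 0"]) (simp add: bimonom_def)
next
  case (add f m)
  then obtain a b where ab: "sum a UNIV = size m" "sum b UNIV = size m" "(\<lambda>x. \<Prod>f\<in>#m. f x) = (\<lambda>x. bimonom a b (r x))"
    by auto
  obtain k j where f: "f = (\<lambda>x. r x $ k * cnj (r x $ j))" using add.prems by auto
  have "(\<lambda>x. \<Prod>f\<in>#add_mset f m. f x) = (\<lambda>x. bimonom (a(k := Suc (a k))) (b(j := Suc (b j))) (r x))"
    using fun_cong[OF ab(3)]
    by (simp add: f nth_mult_bimonom[symmetric] cnj_nth_mult_bimonom[symmetric] mult.assoc mult.left_commute del: fun_upd_apply)
  moreover have "sum (a(k := Suc (a k))) UNIV = size (add_mset f m)" "sum (b(j := Suc (b j))) UNIV = size (add_mset f m)"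
    by (simp_all add: sum_upd_Suc ab del: fun_upd_apply)
  ultimately show ?case by blast
qed

lemma prod_power_in_simplex_polys:
  assumes "sum b UNIV \<le> d"
  shows "(\<lambda>y. \<Prod>i\<in>UNIV. (y $ i) ^ b i) \<in> polys (simplex_space :: (real ^ 'n, real) cub_space) d"
proof -
  have "\<exists>m. set_mset m \<subseteq> {(\<lambda>y::real^'n. y $ i) | i. True} \<and> size m = sum b A \<and>
      (\<forall>y. (\<Prod>f\<in>#m. f y) = (\<Prod>i\<in>A. (y $ i) ^ b i))" if "finite A" for A
    using that
  proof (induction A)
    case empty
    then show ?case by (intro exI[of _ "{#}"]) simp
  next
    case (insert i A)
    then obtain m where m: "set_mset m \<subseteq> {(\<lambda>y::real^'n. y $ i) | i. True}" "size m = sum b A"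
      "\<And>y. (\<Prod>f\<in>#m. f y) = (\<Prod>i\<in>A. (y $ i) ^ b i)" by blast
    then show ?case
      using insert(1,2)
      by (intro exI[of _ "replicate_mset (b i) (\<lambda>y. y $ i) + m"]) (auto split: if_splits)
  qed
  from this[of UNIV] obtain m where m: "set_mset m \<subseteq> {(\<lambda>y::real^'n. y $ i) | i. True}" "size m = sum b UNIV"
      "\<And>y. (\<Prod>f\<in>#m. f y) = (\<Prod>i\<in>UNIV. (y $ i) ^ b i)" by auto
  have "(\<lambda>y. \<Prod>f\<in>#m. f y) \<in> poly_deg_le {(\<lambda>y::real^'n. y $ i) | i. True} d"
    using m assms by (intro prod_mset_in_poly_deg_le) auto
  then show ?thesis by (simp add: m(3) simplex_space_def)
qed

section \<open>Twisted products\<close>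

lemma twisted_product_nodes:
  "nodes (twisted_product act q FT FY) = (\<lambda>(g, p). act g (q p)) ` (nodes FT \<times> nodes FY)"
  by (auto simp: twisted_product_def)

lemma twisted_product_weight:
  "weight (twisted_product act q FT FY) x =
    (\<Sum>(g, p) \<in> {(g, p) \<in> nodes FT \<times> nodes FY. act g (q p) = x}. weight FY p * weight FT g)"
  by (simp add: twisted_product_def)

text \<open>A merged weight is a sum over a fiber of (g, p) -> g q_p, so the sum over nodes unfolds
  to one over all pairs, coinciding or not. Merging is thereby invisible to exactness.\<close>

lemma twisted_product_sum:
  fixes f :: "'x \<Rightarrow> 'b::real_vector"
  assumes fin: "finite (nodes FT)" "finite (nodes FY)"
  shows "(\<Sum>x\<in>nodes (twisted_product act q FT FY). weight (twisted_product act q FT FY) x *\<^sub>R f x)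
    = (\<Sum>p\<in>nodes FY. weight FY p *\<^sub>R (\<Sum>g\<in>nodes FT. weight FT g *\<^sub>R f (act g (q p))))"
proof -
  let ?\<phi> = "\<lambda>(g, p). act g (q p)" and ?S = "nodes FT \<times> nodes FY"
  let ?h = "\<lambda>(g, p). (weight FY p * weight FT g) *\<^sub>R f (act g (q p))"
  have "(\<Sum>x\<in>?\<phi> ` ?S. weight (twisted_product act q FT FY) x *\<^sub>R f x)
      = (\<Sum>x\<in>?\<phi> ` ?S. sum ?h {u \<in> ?S. ?\<phi> u = x})"
  proof (intro sum.cong refl)
    fix x
    have "{(g, p) \<in> ?S. act g (q p) = x} = {u \<in> ?S. ?\<phi> u = x}" by auto
    then show "weight (twisted_product act q FT FY) x *\<^sub>R f x = sum ?h {u \<in> ?S. ?\<phi> u = x}"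
      unfolding twisted_product_weight scaleR_left.sum by (intro sum.cong) auto
  qed
  also have "\<dots> = sum ?h ?S"
    using fin by (intro sum.image_gen[symmetric]) auto
  also have "\<dots> = (\<Sum>p\<in>nodes FY. \<Sum>g\<in>nodes FT. (weight FY p * weight FT g) *\<^sub>R f (act g (q p)))"
    by (subst sum.swap) (simp add: sum.cartesian_product)
  finally show ?thesis
    by (simp add: twisted_product_nodes scaleR_sum_right)
qed

text \<open>For an eigenfunction the inner sum factors, and F_T integrates its character
  \<open>\<omega>\<close> exactly. In the applications that integral is 1 or 0: the monomial is
  handed down to F_Y or discarded.\<close>

lemma twisted_product_character:
  fixes f :: "'x \<Rightarrow> complex" and T :: "('g, complex) cub_space"
  assumes T: "cubature T s FT" "nodes FT \<subseteq> carr T" and "finite (nodes FY)"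
    and q: "base_points X \<alpha> FY q"
    and \<omega>: "\<omega> \<in> polys T s" "\<And>g x. g \<in> carr T \<Longrightarrow> x \<in> carr X \<Longrightarrow> f (act g x) = \<omega> g * f x"
  shows "(\<Sum>x\<in>nodes (twisted_product act q FT FY). weight (twisted_product act q FT FY) x *\<^sub>R f x)
    = (\<integral>g. \<omega> g \<partial>meas T) * (\<Sum>p\<in>nodes FY. weight FY p *\<^sub>R f (q p))"
proof -
  have "(\<Sum>g\<in>nodes FT. weight FT g *\<^sub>R f (act g (q p))) = (\<integral>g. \<omega> g \<partial>meas T) * f (q p)"
    if "p \<in> nodes FY" for p
  proof -
    have "(\<Sum>g\<in>nodes FT. weight FT g *\<^sub>R f (act g (q p))) = (\<Sum>g\<in>nodes FT. (weight FT g *\<^sub>R \<omega> g) * f (q p))"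
      using q T that by (intro sum.cong) (auto simp: base_points_def \<omega>(2))
    then show ?thesis
      using T(1) \<omega>(1) by (simp add: cubature_def sum_distrib_right)
  qed
  moreover have "finite (nodes FT)" using T by (simp add: cubature_def)
  ultimately show ?thesis
    using assms(3) by (simp add: twisted_product_sum sum_distrib_left)
qed

text \<open>This isolates what the three projections share. Nodes over different p never coincide
  because \<open>\<alpha>\<close> recovers p; nodes over the same p are distinct where the action is
  free, which is asked only over the interior.\<close>

lemma twisted_product_cubatureI:
  assumes bd: "bdry X = {}" "bdry T = {}"
    and surj: "\<And>p. p \<in> carr Y \<Longrightarrow> \<exists>x\<in>carr X. \<alpha> x = p"
    and act: "\<And>g x. g \<in> carr T \<Longrightarrow> x \<in> carr X \<Longrightarrow> act g x \<in> carr X \<and> \<alpha> (act g x) = \<alpha> x"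
    and free: "\<And>x g g'. x \<in> carr X \<Longrightarrow> \<alpha> x \<in> carr Y - bdry Y \<Longrightarrow> g \<in> carr T \<Longrightarrow> g' \<in> carr T
      \<Longrightarrow> act g x = act g' x \<Longrightarrow> g = g'"
    and exact: "\<And>FY FT q P. cubature Y t FY \<Longrightarrow> nodes FY \<subseteq> carr Y \<Longrightarrow> cubature T s FT \<Longrightarrow>
      nodes FT \<subseteq> carr T \<Longrightarrow> base_points X \<alpha> FY q \<Longrightarrow> P \<in> polys X s \<Longrightarrow>
      (\<integral>x. P x \<partial>meas X) = (\<Sum>x\<in>nodes (twisted_product act q FT FY). weight (twisted_product act q FT FY) x *\<^sub>R P x)"
  shows "twisted_product_cubature X Y T \<alpha> act t s"
  unfolding twisted_product_cubature_def Let_def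
proof (intro allI impI conjI)
  fix FY FT
  assume FY: "cubature Y t FY" "interior_formula Y FY \<or> boundary_formula Y FY"
    and FT: "cubature T s FT" "interior_formula T FT"
  have fin: "finite (nodes FT)" "finite (nodes FY)" using FY FT by (auto simp: cubature_def)
  have Y: "nodes FY \<subseteq> carr Y" using FY(2) by (auto simp: interior_formula_def boundary_formula_def)
  have T: "nodes FT \<subseteq> carr T" using FT(2) by (auto simp: interior_formula_def)
  show "\<exists>q. base_points X \<alpha> FY q"
    using surj Y unfolding base_points_def by (metis subsetD)
  fix q assume q: "base_points X \<alpha> FY q"
  show "cubature X s (twisted_product act q FT FY)"
    unfolding cubature_def using exact[OF FY(1) Y FT(1) T q] fin by (auto simp: twisted_product_nodes)
  show "interior_formula X (twisted_product act q FT FY)"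
    using q T act by (auto simp: interior_formula_def twisted_product_nodes bd base_points_def)
  show "card (nodes (twisted_product act q FT FY)) = card (nodes FT) * card (nodes FY)"
    if int: "interior_formula Y FY"
  proof -
    have "inj_on (\<lambda>(g, p). act g (q p)) (nodes FT \<times> nodes FY)"
    proof (rule inj_onI, clarify)
      fix g p g' p'
      assume *: "g \<in> nodes FT" "p \<in> nodes FY" "g' \<in> nodes FT" "p' \<in> nodes FY" "act g (q p) = act g' (q p')"
      have X: "q p \<in> carr X" "\<alpha> (q p) = p" "q p' \<in> carr X" "\<alpha> (q p') = p'" "g \<in> carr T" "g' \<in> carr T"
        using * q T by (auto simp: base_points_def)
      then have "p = p'" using act *(5) by metis
      moreover from this have "g = g'"
        using free[of "q p" g g'] * X int by (auto simp: interior_formula_def)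
      ultimately show "g = g' \<and> p = p'" by simp
    qed
    then show ?thesis
      unfolding twisted_product_nodes by (simp add: card_image card_cartesian_product)
  qed
  show "card (nodes (twisted_product act q FT FY)) \<le> card (nodes FT) * card (nodes FY)"
    unfolding twisted_product_nodes using fin
    by (metis card_cartesian_product card_image_le finite_cartesian_product)
  show "positive_formula (twisted_product act q FT FY)"
    if pos: "positive_formula FT" "positive_formula FY"
    unfolding positive_formula_def
  proof
    fix x assume x: "x \<in> nodes (twisted_product act q FT FY)"
    \<comment> \<open>As x is a node, this set of pairs is also nonempty, so the merged weight is a
      nonempty finite sum of positive products.\<close>
    have "finite {(g, p) \<in> nodes FT \<times> nodes FY. act g (q p) = x}"
      by (rule finite_subset[of _ "nodes FT \<times> nodes FY"]) (use fin in auto)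
    then show "0 < weight (twisted_product act q FT FY) x"
      unfolding twisted_product_weight using x pos
      by (intro sum_pos) (auto simp: twisted_product_nodes positive_formula_def)
  qed
qed

section \<open>Fibers and orbits of the projections\<close>

text \<open>From a relative interior point y the segment from the vertex \<open>axis i 1\<close> can
  be prolonged beyond y inside the simplex. If y_i were 0, the i-th coordinate would become 1 - e <
  0. Positivity of all coordinates is what makes the torus act freely on the fiber.\<close>

lemma simplex_interior_pos:
  fixes y :: "real ^ 'n"
  assumes "y \<in> simplex_set - rel_frontier simplex_set"
  shows "0 < y $ i"
proof (rule ccontr)
  assume "\<not> 0 < y $ i"
  moreover have "0 \<le> y $ i" using assms by (simp add: simplex_set_def)
  ultimately have y0: "y $ i = 0" by simp
  have "convex (simplex_set :: (real ^ 'n) set)"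
    unfolding convex_def simplex_set_def
    by (auto simp: sum.distrib sum_distrib_left[symmetric])
  moreover have ax: "axis i 1 \<in> (simplex_set :: (real ^ 'n) set)"
    by (auto simp: simplex_set_def axis_def)
  moreover have "y \<in> rel_interior simplex_set"
    using assms closure_subset by (auto simp: rel_frontier_def)
  ultimately obtain e where "e > 1" "(1 - e) *\<^sub>R axis i 1 + e *\<^sub>R y \<in> simplex_set"
    using convex_rel_interior_iff[of "simplex_set :: (real ^ 'n) set" y] by blast
  then have "0 \<le> ((1 - e) *\<^sub>R axis i 1 + e *\<^sub>R y) $ i"
    unfolding simplex_set_def by blast
  with \<open>e > 1\<close> y0 show False by simp
qed

lemma ex_tau2_eq:
  assumes "y \<in> simplex_set"
  shows "\<exists>z. norm z = 1 \<and> tau2 z = y"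
proof -
  define z where "z = (\<chi> i. complex_of_real (sqrt (y $ i)))"
  have z: "tau2 z = y"
    using assms by (simp add: z_def vec_eq_iff tau2_nth simplex_set_def)
  then have "(norm z)\<^sup>2 = 1"
    using assms sum_tau2[of z] by (simp add: simplex_set_def)
  then have "norm z = 1" using norm_ge_zero[of z] by (auto simp: power2_eq_1_iff)
  then show ?thesis using z by blast
qed

lemma tau2_torus_mult: "g \<in> torus_set \<Longrightarrow> tau2 (g * z) = tau2 z"
  by (simp add: vec_eq_iff tau2_nth torus_set_def norm_mult)

lemma norm_torus_mult: "g \<in> torus_set \<Longrightarrow> norm (g * z) = norm z"
  using sum_tau2[of "g * z"] sum_tau2[of z] by (simp add: tau2_torus_mult)

lemma hopf_scale:
  assumes "c \<noteq> 0"
  shows "hopf (c *s z) = hopf z"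
proof (intro equalityI subsetI)
  fix w assume "w \<in> hopf (c *s z)"
  then show "w \<in> hopf z" by (auto simp: hopf_def)
next
  fix w assume "w \<in> hopf z"
  then obtain d where "w = d *s z" by (auto simp: hopf_def)
  then have "w = (d / c) *s (c *s z)" using assms by simp
  then show "w \<in> hopf (c *s z)" unfolding hopf_def by blast
qed

lemma phase_class_scale:
  assumes "cmod c = 1"
  shows "phase_class (c *s z) = phase_class z"
proof (intro equalityI subsetI)
  fix w assume "w \<in> phase_class (c *s z)"
  then obtain d where "cmod d = 1" "w = (d * c) *s z" by (auto simp: phase_class_def)
  moreover from this have "cmod (d * c) = 1" using assms by (simp add: norm_mult)
  ultimately show "w \<in> phase_class z" unfolding phase_class_def by blast
next
  fix w assume "w \<in> phase_class z"
  then obtain d where d: "cmod d = 1" "w = d *s z" by (auto simp: phase_class_def)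
  have "c \<noteq> 0" using assms by auto
  then have "w = (d / c) *s (c *s z)" "cmod (d / c) = 1" using assms d by (simp_all add: norm_divide)
  then show "w \<in> phase_class (c *s z)" unfolding phase_class_def by blast
qed

lemma hopf_eqD:
  assumes "hopf w = hopf z"
  shows "\<exists>c. w = c *s z"
proof -
  have "1 *s w \<in> hopf w" unfolding hopf_def by blast
  then show ?thesis unfolding assms by (simp add: hopf_def)
qed

lemma class_mult_hopf: "class_mult (phase_class g) (hopf z) = hopf (g * z)"
proof (intro equalityI subsetI)
  fix w assume "w \<in> class_mult (phase_class g) (hopf z)"
  then obtain c d where "w = (c *s g) * (d *s z)"
    by (auto simp: class_mult_def phase_class_def hopf_def)
  then show "w \<in> hopf (g * z)"
    unfolding hopf_def by (auto simp: scale_mult_scale)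
next
  fix w assume "w \<in> hopf (g * z)"
  then obtain c where "w = c *s (g * z)"
    by (auto simp: hopf_def)
  then have "w = (1 *s g) * (c *s z)"
    by (simp only: scale_mult_scale mult_1)
  moreover have "1 *s g \<in> phase_class g" "c *s z \<in> hopf z"
    using norm_one unfolding phase_class_def hopf_def by blast+
  ultimately show "w \<in> class_mult (phase_class g) (hopf z)"
    unfolding class_mult_def by blast
qed

lemma moment_map_hopf:
  assumes "norm z = 1"
  shows "moment_map (hopf z) = tau2 z"
  using unit_rep_hopf[OF assms] by (auto simp: moment_map_def vec_eq_iff tau2_nth norm_mult)

lemma tau2_unit_rep: "tau2 (unit_rep L) = moment_map L"
  by (simp add: moment_map_def vec_eq_iff tau2_nth)

text \<open>The map r is any choice of lifts through \<open>tau2\<close>: the base points themselves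
  on the sphere, their unit representatives in projective space.\<close>

lemma simplex_cubature_bimonom:
  assumes "cubature simplex_space t FY" "sum b UNIV \<le> t"
    and "\<And>p. p \<in> nodes FY \<Longrightarrow> tau2 (r p) = p"
  shows "(\<Sum>p\<in>nodes FY. weight FY p *\<^sub>R bimonom b b (r p)) = (\<integral>z. bimonom b b z \<partial>sphere_measure)"
proof -
  have "(\<integral>y. (\<Prod>i\<in>UNIV. (y $ i) ^ b i) \<partial>simplex_measure) = (\<Sum>p\<in>nodes FY. weight FY p *\<^sub>R (\<Prod>i\<in>UNIV. (p $ i) ^ b i))"
    using assms(1) prod_power_in_simplex_polys[OF assms(2)] by (simp add: cubature_def simplex_space_def)
  then have "(\<integral>z. bimonom b b z \<partial>sphere_measure) = of_real (\<Sum>p\<in>nodes FY. weight FY p *\<^sub>R (\<Prod>i\<in>UNIV. (p $ i) ^ b i))"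
    by (simp only: integral_simplex_measure[symmetric])
  also have "\<dots> = (\<Sum>p\<in>nodes FY. weight FY p *\<^sub>R bimonom b b (r p))"
    by (simp add: bimonom_diag assms(3) scaleR_conv_of_real)
  finally show ?thesis by simp
qed

section \<open>The three projections\<close>

lemma twisted_product_cubature_hopf:
  assumes \<mu>: "unitarily_invariant \<mu>" and \<nu>: "haar_circle \<nu>"
  shows "twisted_product_cubature (sphere_space :: (complex ^ 'n, real) cub_space)
           (cp_space \<mu>) (circle_space \<nu>) hopf (\<lambda>g z. g *s z) t (2 * t + 1)"
proof (rule twisted_product_cubatureI)
  fix x :: "complex ^ 'n" and g g'
  assume "x \<in> carr sphere_space" and eq: "g *s x = g' *s x"
  then have "x \<noteq> 0" by (auto simp: sphere_space_def)
  then show "g = g'" using eq by simp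
next
  fix FY :: "(complex ^ 'n) set formula" and FT q and P :: "complex ^ 'n \<Rightarrow> real"
  assume FY: "cubature (cp_space \<mu>) t FY" and FT: "cubature (circle_space \<nu>) (2 * t + 1) FT"
    "nodes FT \<subseteq> carr (circle_space \<nu>)" and q: "base_points sphere_space hopf FY q"
    and P: "P \<in> polys sphere_space (2 * t + 1)"
  let ?F = "twisted_product (\<lambda>g z. g *s z) q FT FY"
  have "(\<integral>z. P z \<partial>sphere_measure) = (\<Sum>x\<in>nodes ?F. weight ?F x *\<^sub>R P x)"
  proof (rule sphere_exactI[OF _ P])
    fix a b :: "'n \<Rightarrow> nat" assume deg: "sum a UNIV + sum b UNIV \<le> 2 * t + 1"
    define k where "k = int (sum a UNIV) - int (sum b UNIV)"
    have "\<bar>k\<bar> \<le> int (2 * t + 1)"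
      unfolding k_def using deg by linarith
    then have pol: "(\<lambda>z. z powi k) \<in> polys (circle_space \<nu>) (2 * t + 1)"
      by (auto simp: circle_space_def intro!: lin_span_base)
    have *: "(\<Sum>x\<in>nodes ?F. weight ?F x *\<^sub>R bimonom a b x)
       = (\<integral>g. g powi k \<partial>meas (circle_space \<nu>)) * (\<Sum>p\<in>nodes FY. weight FY p *\<^sub>R bimonom a b (q p))"
      by (rule twisted_product_character[OF FT _ q pol])
         (use FY in \<open>simp_all add: cubature_def circle_space_def bimonom_scale k_def unit_power_mult_cnj_power del: of_nat_sum\<close>)
    show "(\<integral>z. bimonom a b z \<partial>sphere_measure) = (\<Sum>x\<in>nodes ?F. weight ?F x *\<^sub>R bimonom a b x)"
    proof (cases "sum a UNIV = sum b UNIV")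
      case False
      then have "k \<noteq> 0" by (simp add: k_def del: of_nat_sum)
      with False show ?thesis
        using haar_circle_integral[OF \<nu>, of k] by (simp add: * circle_space_def integral_sphere_bimonom_unbalanced)
    next
      case True
      \<comment> \<open>Balance gives 2 |b| \<le> 2t + 1, hence |b| \<le> t by integrality; |b| is
        the degree on projective space.\<close>
      have "(\<lambda>L. bimonom a b (unit_rep L)) \<in> polys (cp_space \<mu>) t"
        using bimonom_in_poly_deg_le[OF True, of t unit_rep] True deg by (simp add: cp_space_def)
      then have "(\<Sum>p\<in>nodes FY. weight FY p *\<^sub>R bimonom a b (unit_rep p)) = (\<integral>L. bimonom a b (unit_rep L) \<partial>\<mu>)"
        using FY by (simp add: cubature_def cp_space_def)
      moreover have "bimonom a b (unit_rep p) = bimonom a b (q p)" if "p \<in> nodes FY" for p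
        using q that phase_invariant_unit_rep[OF phase_invariant_bimonom[OF True], of "q p"]
        by (auto simp: base_points_def sphere_space_def)
      ultimately have "(\<Sum>p\<in>nodes FY. weight FY p *\<^sub>R bimonom a b (q p)) = (\<integral>L. bimonom a b (unit_rep L) \<partial>\<mu>)"
        by simp
      also have "\<dots> = (\<integral>z. bimonom a b z \<partial>sphere_measure)"
        by (rule unitary_moments_eq[OF unitary_moments_cp[OF \<mu>] sphere.unitary_moments_axioms True])
      finally show ?thesis
        using haar_circle_integral[OF \<nu>, of k] True by (simp add: * circle_space_def k_def)
    qed
  qed
  then show "(\<integral>x. P x \<partial>meas sphere_space) = (\<Sum>x\<in>nodes ?F. weight ?F x *\<^sub>R P x)"
    by (simp add: sphere_space_def)
qed (auto simp: sphere_space_def circle_space_def cp_space_def norm_vec_scale intro!: hopf_scale)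

text \<open>Both representatives are determined only up to a phase, and balanced monomials ignore
  phases, so multiplicativity survives the choices.\<close>

lemma bimonom_unit_rep_class_mult:
  assumes "G \<in> phase_class ` torus_set" "L \<in> hopf ` sphere 0 1" and deg: "sum a UNIV = sum b UNIV"
  shows "bimonom a b (unit_rep (class_mult G L)) = bimonom a b (class_rep G) * bimonom a b (unit_rep L)"
proof -
  obtain g z where "g \<in> torus_set" "norm z = 1" "G = phase_class g" "L = hopf z"
    using assms by auto
  then show ?thesis
    using phase_invariant_unit_rep[OF phase_invariant_bimonom[OF deg]]
    by (simp add: class_mult_hopf norm_torus_mult bimonom_class_rep[OF deg] bimonom_mult)
qed

lemma twisted_product_cubature_moment_map:
  assumes \<mu>: "unitarily_invariant \<mu>" and \<nu>: "haar_psu_torus \<nu>"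
  shows "twisted_product_cubature (cp_space \<mu> :: ((complex ^ 'n) set, complex) cub_space)
           simplex_space (psu_torus_space \<nu>) moment_map class_mult t t"
proof (rule twisted_product_cubatureI)
  interpret unitary_moments \<mu> unit_rep by (rule unitary_moments_cp[OF \<mu>])
  fix FY :: "(real ^ 'n) formula" and FT q P
  assume FY: "cubature simplex_space t FY" and FT: "cubature (psu_torus_space \<nu>) t FT"
    "nodes FT \<subseteq> carr (psu_torus_space \<nu>)" and q: "base_points (cp_space \<mu>) moment_map FY q"
    and P: "P \<in> polys (cp_space \<mu>) t"
  let ?F = "twisted_product class_mult q FT FY"
  let ?C = "{(\<lambda>L::(complex^'n) set. unit_rep L $ k * cnj (unit_rep L $ j)) | k j. True}"
  have base: "(\<integral>L. bimonom a b (unit_rep L) \<partial>\<mu>) = (\<Sum>x\<in>nodes ?F. weight ?F x *\<^sub>R bimonom a b (unit_rep x))"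
    if deg: "sum a UNIV = sum b UNIV" "sum b UNIV \<le> t" for a b
  proof -
    have pol: "(\<lambda>G. bimonom a b (class_rep G)) \<in> polys (psu_torus_space \<nu>) t"
      using bimonom_in_poly_deg_le[OF deg, of class_rep] by (simp add: psu_torus_space_def)
    have *: "(\<Sum>x\<in>nodes ?F. weight ?F x *\<^sub>R bimonom a b (unit_rep x))
       = (\<integral>G. bimonom a b (class_rep G) \<partial>meas (psu_torus_space \<nu>)) * (\<Sum>p\<in>nodes FY. weight FY p *\<^sub>R bimonom a b (unit_rep (q p)))"
      by (rule twisted_product_character[where f="\<lambda>L. bimonom a b (unit_rep L)", OF FT _ q pol])
         (use FY deg in \<open>simp_all add: cubature_def psu_torus_space_def cp_space_def bimonom_unit_rep_class_mult\<close>)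
    show ?thesis
    proof (cases "a = b")
      case False
      then show ?thesis
        using haar_psu_torus_integral[OF \<nu> deg(1)] deg
        by (simp add: * psu_torus_space_def integral_bimonom_off_diag)
    next
      case True
      have "tau2 (unit_rep (q p)) = p" if "p \<in> nodes FY" for p
        using q that by (simp add: tau2_unit_rep base_points_def)
      then have "(\<Sum>p\<in>nodes FY. weight FY p *\<^sub>R bimonom a b (unit_rep (q p))) = (\<integral>z. bimonom a b z \<partial>sphere_measure)"
        using FY deg True by (simp add: simplex_cubature_bimonom)
      \<comment> \<open>The detour through the sphere is taken because the simplex measure has been
        identified as an image of the sphere measure only.\<close>
      also have "\<dots> = (\<integral>L. bimonom a b (unit_rep L) \<partial>\<mu>)"
        by (rule unitary_moments_eq[OF sphere.unitary_moments_axioms unitary_moments_axioms deg(1)])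
      finally show ?thesis
        unfolding * using haar_psu_torus_integral[OF \<nu> deg(1)] True by (simp add: psu_torus_space_def)
    qed
  qed
  have "P \<in> lin_span {(\<lambda>x. \<Prod>f\<in>#m. f x) | m. set_mset m \<subseteq> ?C \<and> size m \<le> t}"
    using P by (simp add: cp_space_def poly_deg_le_def)
  then have "integrable \<mu> P \<and> (\<integral>L. P L \<partial>\<mu>) = (\<Sum>x\<in>nodes ?F. weight ?F x *\<^sub>R P x)"
  proof (induct rule: lin_span_induct)
    case (scale c f)
    then obtain m where f: "f = (\<lambda>x. \<Prod>f\<in>#m. f x)" and m: "set_mset m \<subseteq> ?C" "size m \<le> t"
      by auto
    obtain a b where ab: "sum a UNIV = size m" "sum b UNIV = size m" "f = (\<lambda>L. bimonom a b (unit_rep L))"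
      unfolding f using prod_mset_eq_bimonom[OF m(1)] by blast
    then have "integrable \<mu> f" "(\<integral>L. f L \<partial>\<mu>) = (\<Sum>x\<in>nodes ?F. weight ?F x *\<^sub>R f x)"
      using base[of a b] m(2) by (auto intro!: integrable_bimonom)
    then show ?case by (simp add: sum_distrib_left)
  qed (auto simp: scaleR_add_right sum.distrib)
  then show "(\<integral>L. P L \<partial>meas (cp_space \<mu>)) = (\<Sum>x\<in>nodes ?F. weight ?F x *\<^sub>R P x)"
    by (simp add: cp_space_def)
next
  fix p :: "real ^ 'n" assume "p \<in> carr simplex_space"
  then obtain z where "norm z = 1" "tau2 z = p"
    using ex_tau2_eq by (auto simp: simplex_space_def)
  then show "\<exists>L\<in>carr (cp_space \<mu>). moment_map L = p"
    by (intro bexI[of _ "hopf z"]) (auto simp: cp_space_def moment_map_hopf)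
next
  fix G and L :: "(complex ^ 'n) set"
  assume "G \<in> carr (psu_torus_space \<nu>)" "L \<in> carr (cp_space \<mu>)"
  then obtain g z where "g \<in> torus_set" "norm z = 1" "G = phase_class g" "L = hopf z"
    by (auto simp: psu_torus_space_def cp_space_def)
  then show "class_mult G L \<in> carr (cp_space \<mu>) \<and> moment_map (class_mult G L) = moment_map L"
    by (auto simp: class_mult_hopf cp_space_def norm_torus_mult moment_map_hopf tau2_torus_mult)
next
  fix L G G' :: "(complex ^ 'n) set"
  assume L: "L \<in> carr (cp_space \<mu>)" "moment_map L \<in> carr simplex_space - bdry simplex_space"
    and G: "G \<in> carr (psu_torus_space \<nu>)" "G' \<in> carr (psu_torus_space \<nu>)" "class_mult G L = class_mult G' L"
  obtain z where z: "norm z = 1" "L = hopf z" using L by (auto simp: cp_space_def)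
  obtain g g' where g: "g \<in> torus_set" "G = phase_class g" "g' \<in> torus_set" "G' = phase_class g'"
    using G by (auto simp: psu_torus_space_def)
  have nz: "z $ i \<noteq> 0" for i
    using simplex_interior_pos[of "tau2 z" i] L z by (auto simp: simplex_space_def moment_map_hopf tau2_nth)
  obtain c where c: "g * z = c *s (g' * z)"
    using G(3) hopf_eqD unfolding z g class_mult_hopf by blast
  have gc: "g = c *s g'"
    using c nz by (auto simp: vec_eq_iff)
  \<comment> \<open>Equality of lines gives only a complex factor c. Since the entries of g and g'
    have modulus 1, c is a phase and the two cosets agree.\<close>
  have "cmod (g $ i) = cmod c * cmod (g' $ i)" for i by (simp add: gc norm_mult)
  then have c1: "cmod c = 1" using g by (simp add: torus_set_def)
  show "G = G'" by (simp add: g gc phase_class_scale[OF c1])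
qed (auto simp: cp_space_def psu_torus_space_def)

lemma twisted_product_cubature_tau2:
  assumes \<nu>: "haar_torus \<nu>"
  shows "twisted_product_cubature (sphere_space :: (complex ^ 'n, real) cub_space)
           simplex_space (torus_space \<nu>) tau2 (\<lambda>g z. g * z) t (2 * t + 1)"
proof (rule twisted_product_cubatureI)
  fix FY :: "(real ^ 'n) formula" and FT q and P :: "complex ^ 'n \<Rightarrow> real"
  assume FY: "cubature simplex_space t FY" and FT: "cubature (torus_space \<nu>) (2 * t + 1) FT"
    "nodes FT \<subseteq> carr (torus_space \<nu>)" and q: "base_points sphere_space tau2 FY q"
    and P: "P \<in> polys sphere_space (2 * t + 1)"
  let ?F = "twisted_product (\<lambda>g z. g * z) q FT FY"
  have "(\<integral>z. P z \<partial>sphere_measure) = (\<Sum>x\<in>nodes ?F. weight ?F x *\<^sub>R P x)"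
  proof (rule sphere_exactI[OF _ P])
    fix a b :: "'n \<Rightarrow> nat" assume deg: "sum a UNIV + sum b UNIV \<le> 2 * t + 1"
    \<comment> \<open>Torus polynomials are integer powers as functions on the whole vector space;
      \<open>bimonom a b\<close> agrees with \<open>\<omega>\<close> on \<open>torus_set\<close>,
      which is enough for nodes and integrals.\<close>
    define \<omega> where "\<omega> = (\<lambda>g::complex^'n. \<Prod>i\<in>UNIV. (g $ i) powi (int (a i) - int (b i)))"
    have \<omega>: "bimonom a b g = \<omega> g" if "g \<in> torus_set" for g
      using that by (simp add: \<omega>_def bimonom_torus)
    have "(\<Sum>i\<in>UNIV. \<bar>int (a i) - int (b i)\<bar>) \<le> (\<Sum>i\<in>UNIV. int (a i) + int (b i))"
      by (intro sum_mono) auto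
    also have "\<dots> \<le> int (2 * t + 1)"
      using deg by (simp add: sum.distrib flip: of_nat_sum of_nat_add)
    finally have pol: "\<omega> \<in> polys (torus_space \<nu>) (2 * t + 1)"
      unfolding \<omega>_def by (auto simp: torus_space_def intro!: lin_span_base exI[of _ "\<lambda>i. int (a i) - int (b i)"])
    have *: "(\<Sum>x\<in>nodes ?F. weight ?F x *\<^sub>R bimonom a b x)
       = (\<integral>g. \<omega> g \<partial>meas (torus_space \<nu>)) * (\<Sum>p\<in>nodes FY. weight FY p *\<^sub>R bimonom a b (q p))"
      by (rule twisted_product_character[OF FT _ q pol])
         (use FY in \<open>simp_all add: cubature_def torus_space_def bimonom_mult \<omega>\<close>)
    have "(\<integral>g. \<omega> g \<partial>\<nu>) = (\<integral>g. bimonom a b g \<partial>\<nu>)"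
      using invariant_prob_space(1)[OF \<nu>[unfolded haar_torus_def]] \<omega>
      by (intro Bochner_Integration.integral_cong) auto
    then have I: "(\<integral>g. \<omega> g \<partial>meas (torus_space \<nu>)) = (if a = b then 1 else 0)"
      by (simp add: haar_torus_integral[OF \<nu>] torus_space_def)
    show "(\<integral>z. bimonom a b z \<partial>sphere_measure) = (\<Sum>x\<in>nodes ?F. weight ?F x *\<^sub>R bimonom a b x)"
    proof (cases "a = b")
      case False
      \<comment> \<open>Two reasons combine: scalar phases when the degrees of a and b differ,
        diagonal unitaries when they agree.\<close>
      then have "(\<integral>z. bimonom a b z \<partial>sphere_measure) = 0"
        using integral_sphere_bimonom_unbalanced sphere.integral_bimonom_off_diag by blast
      with False show ?thesis unfolding * I by simp
    next
      case True
      have "(\<Sum>p\<in>nodes FY. weight FY p *\<^sub>R bimonom a b (q p)) = (\<integral>z. bimonom a b z \<partial>sphere_measure)"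
        using FY deg q True by (auto simp: base_points_def intro!: simplex_cubature_bimonom)
      then show ?thesis unfolding * I using True by simp
    qed
  qed
  then show "(\<integral>x. P x \<partial>meas sphere_space) = (\<Sum>x\<in>nodes ?F. weight ?F x *\<^sub>R P x)"
    by (simp add: sphere_space_def)
next
  fix p :: "real ^ 'n" assume "p \<in> carr simplex_space"
  then show "\<exists>x\<in>carr sphere_space. tau2 x = p"
    using ex_tau2_eq[of p] by (auto simp: simplex_space_def sphere_space_def)
next
  fix x g g' :: "complex ^ 'n"
  assume x: "tau2 x \<in> carr simplex_space - bdry simplex_space" and eq: "g * x = g' * x"
  have "x $ i \<noteq> 0" for i
    using simplex_interior_pos[of "tau2 x" i] x by (auto simp: simplex_space_def tau2_nth)
  then show "g = g'" using eq by (auto simp: vec_eq_iff)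
qed (auto simp: sphere_space_def torus_space_def norm_torus_mult tau2_torus_mult)

theorem theorem4p1:
  fixes t :: nat
    and \<mu> :: "(complex ^ 'n) set measure"
    and \<nu>1 :: "complex measure"
    and \<nu>2 :: "(complex ^ 'n) set measure"
    and \<nu>3 :: "(complex ^ 'n) measure"
  assumes "unitarily_invariant \<mu>"
    and "haar_circle \<nu>1" and "haar_psu_torus \<nu>2" and "haar_torus \<nu>3"
  shows "twisted_product_cubature (sphere_space :: (complex ^ 'n, real) cub_space)
           (cp_space \<mu>) (circle_space \<nu>1) hopf (\<lambda>g z. g *s z) t (2 * t + 1)
       \<and> twisted_product_cubature (cp_space \<mu>)
           simplex_space (psu_torus_space \<nu>2) moment_map class_mult t t
       \<and> twisted_product_cubature (sphere_space :: (complex ^ 'n, real) cub_space)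
           simplex_space (torus_space \<nu>3) tau2 (\<lambda>g z. g * z) t (2 * t + 1)"
  using assms twisted_product_cubature_hopf twisted_product_cubature_moment_map
    twisted_product_cubature_tau2 by blast

end
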